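(* Let $(X,+)$ be a $3$-divisible abelian group and $C$ a $3$-divisible cyclic group. For a loop $Q$ the following are equivalent: (i) $Q$ is a Moufang loop containing $X$ as a normal subloop and $C$ as a subloop with $Q=CX$ and $C\cap X=1$; (ii) $Q$ is isomorphic to $C\ltimes_{(f^3,\beta)}X$ for some Moufang permutation $f$ on $(X,+)$ with associated biadditive mapping $\beta$ (such that this loop is defined, i.e., if $C$ is finite then $|f^3|$ and $r(f^3,\beta)$ divide $|C|$).
   Context: A loop is Moufang if it satisfies $xy\cdot zx=(x\cdot yz)x$ for all $x,y,z$. A group is $3$-divisible if every element is a cube. A permutation $f$ of $(X,+)$ is a Moufang permutation if $\beta(x,y)=f^{-1}(f(x)+f(y))-x-y$ is symmetric, alternating and biadditive, and for all $x,y,z$: $\beta(\beta(x,y),z)=0$ and $\beta(f(x),f(y))=f(\beta(f^3(x),y))$; $\beta$ is the associated biadditive mapping. $\mathrm{Rad}(\beta)=\{x:\beta(x,y)=0\ \forall y\}$; for a permutation $g$ and such $\gamma$, $r(g,\gamma)$ is the least positive $r$ with $\sum_{0\le k<r}g^k(x)\in\mathrm{Rad}(\gamma)$ for all $x$ ($\infty$ if none). $I(i,j)$ is $\emptyset$ if $i=j$, $\{i,\dots,j-1\}$ if $i<j$, $\{j,\dots,i-1\}$ if $j<i$. For $C=\langle b\rangle$ and $(g,\gamma)=(f^3,\beta)$, $C\ltimes_{(g,\gamma)}X$ is the loop on $C\times X$ with multiplication $(b^i,x)(b^j,y)=(b^{i+j},g^{-j}(x)+y+\sum_{k\in I(i+j,-j)}g^{-k}(\gamma(x,y)))$.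 *)

theory Defs
  imports "HOL-Algebra.Group"
begin

definition loop :: "('a, 'b) monoid_scheme \<Rightarrow> bool" where
  "loop Q \<longleftrightarrow>
     \<one>\<^bsub>Q\<^esub> \<in> carrier Q \<and>
     (\<forall>x\<in>carrier Q. \<forall>y\<in>carrier Q. x \<otimes>\<^bsub>Q\<^esub> y \<in> carrier Q) \<and>
     (\<forall>x\<in>carrier Q. \<one>\<^bsub>Q\<^esub> \<otimes>\<^bsub>Q\<^esub> x = x \<and> x \<otimes>\<^bsub>Q\<^esub> \<one>\<^bsub>Q\<^esub> = x) \<and>
     (\<forall>a\<in>carrier Q. \<forall>c\<in>carrier Q. \<exists>!x. x \<in> carrier Q \<and> a \<otimes>\<^bsub>Q\<^esub> x = c) \<and>
     (\<forall>a\<in>carrier Q. \<forall>c\<in>carrier Q. \<exists>!y. y \<in> carrier Q \<and> y \<otimes>\<^bsub>Q\<^esub> a = c)"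

definition moufang_loop :: "('a, 'b) monoid_scheme \<Rightarrow> bool" where
  "moufang_loop Q \<longleftrightarrow> loop Q \<and>
     (\<forall>x\<in>carrier Q. \<forall>y\<in>carrier Q. \<forall>z\<in>carrier Q.
        (x \<otimes>\<^bsub>Q\<^esub> y) \<otimes>\<^bsub>Q\<^esub> (z \<otimes>\<^bsub>Q\<^esub> x)
        = (x \<otimes>\<^bsub>Q\<^esub> (y \<otimes>\<^bsub>Q\<^esub> z)) \<otimes>\<^bsub>Q\<^esub> x)"

definition subloop :: "('a, 'b) monoid_scheme \<Rightarrow> 'a set \<Rightarrow> bool" where
  "subloop Q S \<longleftrightarrow> S \<subseteq> carrier Q \<and> loop (Q\<lparr>carrier := S\<rparr>)"

definition normal_subloop :: "('a, 'b) monoid_scheme \<Rightarrow> 'a set \<Rightarrow> bool" where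
  "normal_subloop Q N \<longleftrightarrow> subloop Q N \<and>
     (\<forall>x\<in>carrier Q. \<forall>y\<in>carrier Q.
        {x \<otimes>\<^bsub>Q\<^esub> n | n. n \<in> N} = {n \<otimes>\<^bsub>Q\<^esub> x | n. n \<in> N} \<and>
        {(x \<otimes>\<^bsub>Q\<^esub> n) \<otimes>\<^bsub>Q\<^esub> y | n. n \<in> N} = {x \<otimes>\<^bsub>Q\<^esub> (n \<otimes>\<^bsub>Q\<^esub> y) | n. n \<in> N} \<and>
        {y \<otimes>\<^bsub>Q\<^esub> (x \<otimes>\<^bsub>Q\<^esub> n) | n. n \<in> N} = {(y \<otimes>\<^bsub>Q\<^esub> x) \<otimes>\<^bsub>Q\<^esub> n | n. n \<in> N})"

definition add_loop :: "'x::ab_group_add monoid" where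
  "add_loop = \<lparr>carrier = UNIV, monoid.mult = (+), one = 0\<rparr>"

definition assoc_beta :: "('x::ab_group_add \<Rightarrow> 'x) \<Rightarrow> 'x \<Rightarrow> 'x \<Rightarrow> 'x" where
  "assoc_beta f x y = inv_into UNIV f (f x + f y) - x - y"

definition moufang_perm :: "('x::ab_group_add \<Rightarrow> 'x) \<Rightarrow> bool" where
  "moufang_perm f \<longleftrightarrow> bij f \<and>
     (\<forall>x y. assoc_beta f x y = assoc_beta f y x) \<and>
     (\<forall>x. assoc_beta f x x = 0) \<and>
     (\<forall>x y z. assoc_beta f (x + y) z = assoc_beta f x z + assoc_beta f y z \<and>
              assoc_beta f x (y + z) = assoc_beta f x y + assoc_beta f x z) \<and>
     (\<forall>x y z. assoc_beta f (assoc_beta f x y) z = 0) \<and>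
     (\<forall>x y. assoc_beta f (f x) (f y) = f (assoc_beta f ((f ^^ 3) x) y))"

definition Rad :: "('x \<Rightarrow> 'x \<Rightarrow> 'x::zero) \<Rightarrow> 'x set" where
  "Rad \<gamma> = {x. \<forall>y. \<gamma> x y = 0}"

text \<open>r(g,gamma); the value 0 encodes \<open>\<infinity>\<close>.\<close>
definition r_index :: "('x::ab_group_add \<Rightarrow> 'x) \<Rightarrow> ('x \<Rightarrow> 'x \<Rightarrow> 'x) \<Rightarrow> nat" where
  "r_index g \<gamma> =
     (if \<exists>r>0. \<forall>x. (\<Sum>k<r. (g ^^ k) x) \<in> Rad \<gamma>
      then LEAST r. r > 0 \<and> (\<forall>x. (\<Sum>k<r. (g ^^ k) x) \<in> Rad \<gamma>) else 0)"

text \<open>Order of a permutation; the value 0 encodes \<open>\<infinity>\<close>.\<close>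
definition perm_ord :: "('x \<Rightarrow> 'x) \<Rightarrow> nat" where
  "perm_ord g = (if \<exists>n>0. g ^^ n = id then LEAST n. n > 0 \<and> g ^^ n = id else 0)"

definition zpow :: "('x \<Rightarrow> 'x) \<Rightarrow> int \<Rightarrow> 'x \<Rightarrow> 'x" where
  "zpow g k = (if 0 \<le> k then g ^^ nat k else inv_into UNIV g ^^ nat (- k))"

definition Iset :: "int \<Rightarrow> int \<Rightarrow> int set" where
  "Iset i j = (if i = j then {} else if i < j then {i..j - 1} else {j..i - 1})"

definition dlog :: "('c, 'd) monoid_scheme \<Rightarrow> 'c \<Rightarrow> 'c \<Rightarrow> int" where
  "dlog C b c = (SOME i::int. c = b [^]\<^bsub>C\<^esub> i)"

definition sdp_loop :: "('c, 'd) monoid_scheme \<Rightarrow> 'c \<Rightarrow> ('x::ab_group_add \<Rightarrow> 'x)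
    \<Rightarrow> ('x \<Rightarrow> 'x \<Rightarrow> 'x) \<Rightarrow> ('c \<times> 'x) monoid" where
  "sdp_loop C b g \<gamma> =
    \<lparr>carrier = carrier C \<times> UNIV,
     monoid.mult = (\<lambda>(c, x) (d, y).
        let i = dlog C b c; j = dlog C b d in
        (c \<otimes>\<^bsub>C\<^esub> d,
         zpow g (- j) x + y + (\<Sum>k\<in>Iset (i + j) (- j). zpow g (- k) (\<gamma> x y)))),
     one = (\<one>\<^bsub>C\<^esub>, 0)\<rparr>"

end

theory Submission
  imports Defs "HOL-Algebra.Multiplicative_Group"
begin

text \<open>
  A 3-divisible cyclic group \<open>C = \<langle>b\<rangle>\<close> is finite of order prime to 3, so \<open>b = a\<^sup>3\<close> for another generator
  \<open>a\<close>. In a Moufang loop \<open>Q = CX\<close>, let \<open>f\<close> be conjugation by \<open>a\<close> on \<open>X\<close>. The autotopisms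
  \<open>(L\<^sub>cR\<^sub>c, L\<^sub>c\<inverse>, L\<^sub>c)\<close> and \<open>(R\<^sub>d\<inverse>, L\<^sub>dR\<^sub>d, R\<^sub>d)\<close> with suitable powers \<open>c, d\<close> of \<open>a\<close> move both factors of a
  product into \<open>X\<close> and show that the \<open>X\<close>-component of \<open>(b^i x)(b^j y)\<close> is
  \<open>f^(-i-2j) (f^(i-j) x + f^(i+2j) y)\<close>. The Moufang identity for this formula
  makes \<open>x \<circ>\<^sub>m y - x - y\<close> biadditive, where \<open>x \<circ>\<^sub>m y = f^(-m) (f^m x + f^m y)\<close>, and
  forces \<open>f\<close> to be a Moufang permutation. Conversely, for a Moufang permutation with \<open>g = f\<^sup>3\<close>
  one has \<open>g^(-k) \<beta>(x,y) = \<beta>(g^k x, y)\<close> and \<open>2\<beta> = 0\<close>, so every interval sum of these terms is a sum of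
  two partial sums \<open>S n\<close>; the formula above then equals the multiplication of the semidirect
  product, and the Moufang identity becomes a cancellation of terms \<open>S n\<close>.
\<close>

section \<open>Integer powers of a permutation\<close>

lemma zpow_0 [simp]: "zpow f 0 x = x"
  by (simp add: zpow_def)

lemma zpow_of_nat: "zpow f (int n) x = (f ^^ n) x"
  by (simp add: zpow_def)

lemma zpow_Suc:
  assumes "bij f"
  shows "zpow f (k + 1) x = f (zpow f k x)"
proof (cases "0 \<le> k")
  case True
  then have "nat (k + 1) = Suc (nat k)" by simp
  with True show ?thesis by (simp add: zpow_def)
next
  case False
  define n where "n = nat (- k - 1)"
  from False have k: "k = - int (Suc n)" by (simp add: n_def)
  have "zpow f (k + 1) x = (inv_into UNIV f ^^ n) x"
    by (cases n) (simp_all add: k zpow_def nat_add_distrib)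
  moreover have "zpow f k x = inv_into UNIV f ((inv_into UNIV f ^^ n) x)"
    by (simp add: k zpow_def nat_add_distrib)
  ultimately show ?thesis
    using assms by (simp add: bij_is_surj surj_f_inv_f)
qed

lemma zpow_pred:
  assumes "bij f"
  shows "zpow f (k - 1) x = inv_into UNIV f (zpow f k x)"
  using zpow_Suc[OF assms, of "k - 1" x] assms
  by (simp add: bij_is_inj)

lemma zpow_add:
  assumes "bij f"
  shows "zpow f (i + j) x = zpow f i (zpow f j x)"
proof (induction i rule: int_induct[where k = 0])
  case (step1 i)
  then show ?case
    using zpow_Suc[OF assms, of "i + j" x] zpow_Suc[OF assms, of i]
    by (simp add: add.assoc add.commute add.left_commute)
next
  case (step2 i)
  then show ?case
    using zpow_pred[OF assms, of "i + j" x] zpow_pred[OF assms, of i]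
    by (simp add: algebra_simps)
qed simp

lemma zpow_1 [simp]: "zpow f 1 x = f x"
  by (simp add: zpow_def)

lemma zpow_minus_1: "zpow f (- 1) x = inv_into UNIV f x"
  by (simp add: zpow_def)

lemma zpow_cancel [simp]:
  assumes "bij f"
  shows "zpow f (- k) (zpow f k x) = x" "zpow f k (zpow f (- k) x) = x"
  using zpow_add[OF assms, of "- k" k x] zpow_add[OF assms, of k "- k" x] by simp_all

lemma zpow_inj:
  assumes "bij f"
  shows "zpow f k x = zpow f k y \<longleftrightarrow> x = y"
  using zpow_cancel(1)[OF assms] by metis

lemma bij_funpow:
  fixes f :: "'a \<Rightarrow> 'a"
  assumes "bij f" shows "bij (f ^^ n)"
  by (rule bij_fn[OF assms])

lemma zpow_funpow:
  assumes "bij f"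
  shows "zpow (f ^^ n) k x = zpow f (int n * k) x"
proof (induction k rule: int_induct[where k = 0])
  case (step1 i)
  then show ?case
    using zpow_Suc[OF bij_funpow[OF assms], of n i x] zpow_add[OF assms, of "int n" "int n * i" x]
    by (simp add: zpow_of_nat algebra_simps)
next
  case (step2 i)
  have "zpow f (int n * i) x = zpow f (int n) (zpow f (int n * i - int n) x)"
    using zpow_add[OF assms, of "int n" "int n * i - int n" x] by simp
  with step2 show ?case
    using zpow_pred[OF bij_funpow[OF assms], of n i x] bij_funpow[OF assms, of n]
    by (simp add: zpow_of_nat right_diff_distrib bij_is_inj)
qed simp

section \<open>Sums over signed intervals in characteristic two\<close>

text \<open>With 0 as base point, the interval between two integers consists of the indices where
  the two intervals based at 0 differ, whatever the signs of the endpoints.\<close>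

lemma Iset_symdiff: "Iset i j = (Iset 0 i - Iset 0 j) \<union> (Iset 0 j - Iset 0 i)"
  by (auto simp: Iset_def split: if_splits)

lemma finite_Iset [simp]: "finite (Iset i j)"
  by (simp add: Iset_def)

text \<open>The common part \<open>A \<inter> B\<close> is counted twice on the right and so
  contributes nothing.\<close>

lemma sum_symdiff_char2:
  fixes h :: "'i \<Rightarrow> 'x::ab_group_add"
  assumes "finite A" "finite B" and two: "\<And>k. h k + h k = 0"
  shows "sum h ((A - B) \<union> (B - A)) = sum h A + sum h B"
proof -
  have A: "sum h A = sum h (A - B) + sum h (A \<inter> B)"
    using assms(1) by (metis Diff_Diff_Int Diff_subset add.commute sum.subset_diff)
  have B: "sum h B = sum h (B - A) + sum h (A \<inter> B)"
    using assms(2) by (metis Diff_Diff_Int Diff_subset Int_commute add.commute sum.subset_diff)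
  have "sum h (A \<inter> B) + sum h (A \<inter> B) = 0"
    by (simp add: two flip: sum.distrib)
  then have "sum h A + sum h B = sum h (A - B) + sum h (B - A)"
    unfolding A B by (simp add: algebra_simps)
  also have "\<dots> = sum h ((A - B) \<union> (B - A))"
    by (rule sum.union_disjoint[symmetric]) (use assms in auto)
  finally show ?thesis by simp
qed

lemma sum_Iset:
  fixes h :: "int \<Rightarrow> 'x::ab_group_add"
  assumes "\<And>k. h k + h k = 0"
  shows "sum h (Iset i j) = sum h (Iset 0 i) + sum h (Iset 0 j)"
  by (subst Iset_symdiff, rule sum_symdiff_char2) (use assms in auto)

text \<open>One recursion serves both signs: for negative n the passage from n to n + 1 drops the
  index n, which amounts to adding \<open>h n\<close> once more.\<close>

lemma sum_Iset_Suc: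
  fixes h :: "int \<Rightarrow> 'x::ab_group_add"
  assumes "\<And>k. h k + h k = 0"
  shows "sum h (Iset 0 (n + 1)) = sum h (Iset 0 n) + h n"
proof -
  have "h n = sum h (Iset (n + 1) n)"
    by (simp add: Iset_def)
  also have "\<dots> = sum h (Iset 0 (n + 1)) + sum h (Iset 0 n)"
    by (rule sum_Iset) (use assms in auto)
  finally have "sum h (Iset 0 n) + h n = sum h (Iset 0 (n + 1)) + (sum h (Iset 0 n) + sum h (Iset 0 n))"
    by (simp add: algebra_simps)
  also have "sum h (Iset 0 n) + sum h (Iset 0 n) = 0"
    by (simp add: assms flip: sum.distrib)
  finally show ?thesis by simp
qed

section \<open>Moufang permutations\<close>

locale mperm =
  fixes f :: "'x::ab_group_add \<Rightarrow> 'x"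
  assumes mp: "moufang_perm f"
begin

abbreviation "\<beta> \<equiv> assoc_beta f"
abbreviation "P \<equiv> zpow f"
abbreviation "Z \<equiv> zpow (f ^^ 3)"

text \<open>Write g for f^3. For n \<ge> 0 this is \<open>\<beta>\<close> of the sum of all g^k x
  with k < n, paired with y; since 2\<beta> = 0, negative n need no sign. The deviations from
  additivity below are expressed through these sums.\<close>

definition S :: "int \<Rightarrow> 'x \<Rightarrow> 'x \<Rightarrow> 'x" where
  "S n x y = (\<Sum>k\<in>Iset 0 n. \<beta> (Z k x) y)"

lemma bij_f: "bij f"
  and sym: "\<beta> x y = \<beta> y x"
  and alt [simp]: "\<beta> x x = 0"
  and add_left: "\<beta> (x + y) z = \<beta> x z + \<beta> y z"
  and add_right: "\<beta> z (x + y) = \<beta> z x + \<beta> z y"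
  and nil [simp]: "\<beta> (\<beta> x y) z = 0"
  and f_beta: "\<beta> (f x) (f y) = f (\<beta> ((f ^^ 3) x) y)"
  using mp unfolding moufang_perm_def by blast+

lemma nil' [simp]: "\<beta> z (\<beta> x y) = 0"
  using nil sym by metis

lemma bij_g: "bij (f ^^ 3)"
  by (rule bij_funpow[OF bij_f])

lemma Z_P: "Z k x = P (3 * k) x"
  using zpow_funpow[OF bij_f, of 3 k x] by simp

lemma Z_add: "Z (i + j) x = Z i (Z j x)"
  by (rule zpow_add[OF bij_g])

lemma P_add: "P (i + j) x = P i (P j x)"
  by (rule zpow_add[OF bij_f])

lemma beta_0 [simp]: "\<beta> 0 y = 0" "\<beta> y 0 = 0"
  using add_left[of 0 0 y] add_right[of y 0 0] by simp_all

lemma inv_f_f [simp]: "inv_into UNIV f (f x) = x" and f_inv_f [simp]: "f (inv_into UNIV f x) = x"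
  using bij_f by (simp_all add: bij_is_inj bij_is_surj surj_f_inv_f)

lemma f_add_beta: "f (x + y + \<beta> x y) = f x + f y"
proof -
  have "x + y + \<beta> x y = inv_into UNIV f (f x + f y)"
    by (simp add: assoc_beta_def)
  then show ?thesis by simp
qed

lemma two [simp]: "\<beta> x y + \<beta> x y = 0"
proof -
  have "\<beta> (x + y) (x + y) = \<beta> x y + \<beta> y x"
    by (simp only: add_left add_right) (simp add: add.commute)
  then have "\<beta> x y + \<beta> y x = 0" by simp
  then show ?thesis using sym[of y x] by simp
qed

lemma f_0 [simp]: "f 0 = 0"
  using f_add_beta[of 0 0] by simp

section \<open>The radical of \<open>\<beta>\<close>, along which f is additive\<close>

abbreviation "R \<equiv> Rad \<beta>"

lemma Rad_left: "r \<in> R \<Longrightarrow> \<beta> r y = 0"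
  by (simp add: Rad_def)

lemma Rad_right: "r \<in> R \<Longrightarrow> \<beta> y r = 0"
  using Rad_left sym by metis

lemma beta_in_Rad [simp]: "\<beta> x y \<in> R"
  by (simp add: Rad_def)

lemma Rad_0 [simp]: "0 \<in> R"
  by (simp add: Rad_def)

lemma Rad_add: "r \<in> R \<Longrightarrow> s \<in> R \<Longrightarrow> r + s \<in> R"
  by (simp add: Rad_def add_left)

lemma sum_in_Rad:
  assumes "\<And>k. h k \<in> R"
  shows "sum h A \<in> R"
  by (induction A rule: infinite_finite_induct) (auto intro: Rad_add assms)

lemma f_add_Rad: "r \<in> R \<Longrightarrow> f (x + r) = f x + f r"
  using f_add_beta[of x r] by (simp add: Rad_right)

text \<open>Exchanging x and y in \<open>f_beta\<close> leaves the left side fixed by symmetry, and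
  f can be cancelled on the right. So g = f^3 is self-adjoint for \<open>\<beta>\<close>.\<close>

lemma beta_g_adjoint: "\<beta> ((f ^^ 3) x) y = \<beta> x ((f ^^ 3) y)"
proof -
  have "f (\<beta> ((f ^^ 3) x) y) = f (\<beta> ((f ^^ 3) y) x)"
    using f_beta[of x y] f_beta[of y x] sym[of "f x" "f y"] by simp
  then show ?thesis
    using inv_f_f sym by metis
qed

text \<open>Writing y as an image under f, \<open>f_beta\<close> and self-adjointness move all
  powers of f away from r, and \<open>f 0 = 0\<close> remains.\<close>

lemma f_Rad: "r \<in> R \<Longrightarrow> f r \<in> R"
proof -
  assume r: "r \<in> R"
  have "\<beta> (f r) y = 0" for y
    using f_beta[of r "inv_into UNIV f y"] r by (simp add: beta_g_adjoint Rad_left)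
  then show ?thesis by (simp add: Rad_def)
qed

lemma inv_f_Rad: "r \<in> R \<Longrightarrow> inv_into UNIV f r \<in> R"
proof -
  assume r: "r \<in> R"
  have "\<beta> (inv_into UNIV f r) y = 0" for y
  proof -
    \<comment> \<open>The witness is g^(-1) y: with it the right side of \<open>f_beta\<close> at
      f^(-1) r and z becomes f of the value to be computed.\<close>
    define z where "z = zpow (f ^^ 3) (- 1) y"
    have y: "y = (f ^^ 3) z"
      using zpow_cancel(2)[OF bij_g, of 1 y] by (simp add: z_def)
    have "f (\<beta> (inv_into UNIV f r) y) = \<beta> r (f z)"
      using f_beta[of "inv_into UNIV f r" z] by (simp add: y beta_g_adjoint)
    also have "\<dots> = f 0" using r by (simp add: Rad_left)
    finally show ?thesis by (metis inv_f_f)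
  qed
  then show ?thesis by (simp add: Rad_def)
qed

lemma inv_f_add_Rad: "r \<in> R \<Longrightarrow> inv_into UNIV f (x + r) = inv_into UNIV f x + inv_into UNIV f r"
  using f_add_Rad[OF inv_f_Rad, of r "inv_into UNIV f x"] by (metis f_inv_f inv_f_f)

lemma P_Rad: "r \<in> R \<Longrightarrow> P k r \<in> R"
  by (induction k rule: int_induct[where k = 0])
    (auto simp: zpow_Suc zpow_pred bij_f f_Rad inv_f_Rad)

lemma P_add_Rad: "r \<in> R \<Longrightarrow> P k (x + r) = P k x + P k r"
  by (induction k rule: int_induct[where k = 0])
    (auto simp: zpow_Suc zpow_pred bij_f f_add_Rad inv_f_add_Rad P_Rad)

lemma Z_add_Rad: "r \<in> R \<Longrightarrow> Z k (x + r) = Z k x + Z k r"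
  by (simp add: Z_P P_add_Rad)

lemma Z_0 [simp]: "Z k 0 = 0"
  using Z_add_Rad[of 0 k 0] by simp

text \<open>Three applications of \<open>f_beta\<close> give \<beta>(g w, g y) = g \<beta>(g^3 w,
  y). With x = g^3 w, self-adjointness turns the left side into \<beta>(g^2 w, y), which is
  \<beta>(g^(-1) x, y). So g acts on values of \<open>\<beta>\<close> inversely to its action on an
  argument.\<close>

lemma g_beta: "(f ^^ 3) (\<beta> x y) = \<beta> (Z (- 1) x) y"
proof -
  define w where "w = Z (- 3) x"
  have w: "x = Z 3 w" using Z_add[of 3 "-3" x] by (simp add: w_def)
  have g: "(f ^^ 3) v = f (f (f v))" for v by (simp add: numeral_3_eq_3)
  have gf: "(f ^^ 3) (f v) = f ((f ^^ 3) v)" for v by (simp add: g)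
  have Z1: "Z 3 w = (f ^^ 3) ((f ^^ 3) ((f ^^ 3) w))"
    using zpow_of_nat[of "f ^^ 3" 3 w] by (simp add: numeral_3_eq_3)
  have Z2: "Z (- 1) x = (f ^^ 3) ((f ^^ 3) w)"
    by (simp add: w Z1 zpow_minus_1 bij_is_inj[OF bij_g])
  have "\<beta> (f (f (f w))) (f (f (f y))) = f (f (f (\<beta> ((f ^^ 3) ((f ^^ 3) ((f ^^ 3) w))) y)))"
    by (simp only: f_beta gf)
  then have "\<beta> ((f ^^ 3) w) ((f ^^ 3) y) = (f ^^ 3) (\<beta> x y)"
    unfolding w Z1 by (simp only: g[symmetric])
  then show ?thesis
    by (simp only: Z2 beta_g_adjoint)
qed

lemma Z_beta: "Z k (\<beta> x y) = \<beta> (Z (- k) x) y"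
proof (induction k arbitrary: x rule: int_induct[where k = 0])
  case (step1 i)
  have "Z (- (i + 1)) x = Z (- 1) (Z (- i) x)"
    by (simp add: algebra_simps flip: Z_add)
  with step1 show ?case by (simp only: zpow_Suc bij_g g_beta)
next
  case (step2 i)
  have "\<beta> (Z (- i) x) y = (f ^^ 3) (\<beta> (Z 1 (Z (- i) x)) y)"
    by (simp only: g_beta zpow_cancel(1)[OF bij_g])
  then have "inv_into UNIV (f ^^ 3) (\<beta> (Z (- i) x) y) = \<beta> (Z 1 (Z (- i) x)) y"
    by (simp only: inv_f_eq[OF bij_is_inj[OF bij_g]])
  then show ?case
    using step2 Z_add[of 1 "-i" x] by (simp add: zpow_pred bij_g)
qed simp

lemma beta_Z_adjoint: "\<beta> (Z k x) y = \<beta> x (Z k y)"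
proof -
  have "\<beta> (Z k x) y = Z (- k) (\<beta> y x)"
    using Z_beta[of "-k" x y] sym by simp
  also have "\<dots> = \<beta> (Z k y) x" using Z_beta[of "-k" y x] by simp
  finally show ?thesis using sym by simp
qed

lemma beta_f_Z: "\<beta> (Z k (f x)) (f y) = f (\<beta> (Z (k + 1) x) y)"
proof -
  have "Z k (f x) = f (Z k x)"
    using P_add[of "3 * k" 1 x] P_add[of 1 "3 * k" x] by (simp add: Z_P add.commute)
  moreover have "(f ^^ 3) (Z k x) = Z (k + 1) x"
    by (simp add: zpow_Suc bij_g)
  ultimately show ?thesis by (simp add: f_beta)
qed

text \<open>Self-adjointness splits an even power evenly between the two arguments, where
  \<open>alt\<close> applies. An odd power reduces in the same way to \<beta>(g v, v), which
  vanishes by \<open>f_beta\<close> with both arguments equal to v.\<close>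

lemma beta_Z_alt [simp]: "\<beta> (Z k x) x = 0"
proof -
  have 1: "\<beta> (Z 1 v) v = 0" for v
    using f_beta[of v v] by (metis alt f_0 inv_f_f zpow_1)
  have 2: "\<beta> (Z (m + (e + m)) x) x = \<beta> (Z e (Z m x)) (Z m x)" for m e
    by (simp only: Z_add beta_Z_adjoint)
  show ?thesis
  proof (cases "even k")
    case True
    then obtain m where "k = m + (0 + m)" by (metis add_0 evenE mult_2)
    then show ?thesis using 2[of m 0] by simp
  next
    case False
    then obtain m where "k = m + (1 + m)" by (metis add.assoc add.commute mult_2 oddE)
    then show ?thesis using 2[of m 1] 1 by metis
  qed
qed

section \<open>Rules for the partial sums \<open>S\<close>\<close>

lemma S_0 [simp]: "S 0 x y = 0"
  by (simp add: S_def Iset_def)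

lemma S_Suc: "S (n + 1) x y = S n x y + \<beta> (Z n x) y"
  unfolding S_def by (rule sum_Iset_Suc) simp

lemma S_two [simp]: "S n x y + S n x y = 0"
  by (simp add: S_def flip: sum.distrib)

lemma S_two_left [simp]: "S n x y + (S n x y + z) = z"
  by (simp flip: add.assoc)

lemma S_pred: "S (n - 1) x y = S n x y + \<beta> (Z (n - 1) x) y"
  using S_Suc[of "n - 1" x y] by (simp add: add.assoc)

lemma S_sym: "S n x y = S n y x"
  unfolding S_def by (rule sum.cong) (use beta_Z_adjoint sym in metis)+

lemma S_alt [simp]: "S n x x = 0"
  by (simp add: S_def)

lemma S_Rad [simp]: "S n x y \<in> R"
  unfolding S_def by (rule sum_in_Rad) simp

lemma S_add_right: "S n x (y + z) = S n x y + S n x z"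
  by (simp add: S_def add_right sum.distrib)

lemma S_add_left: "S n (x + y) z = S n x z + S n y z"
  using S_add_right[of n z x y] by (simp add: S_sym)

lemma S_of_Rad [simp]: "r \<in> R \<Longrightarrow> S n x r = 0" "r \<in> R \<Longrightarrow> S n r x = 0"
proof -
  show *: "r \<in> R \<Longrightarrow> S n x r = 0" by (simp add: S_def Rad_right)
  show "r \<in> R \<Longrightarrow> S n r x = 0" using * by (simp add: S_sym)
qed

lemma S_zero [simp]: "S n 0 y = 0" "S n y 0 = 0"
  by simp_all

text \<open>Index shift: the left side sums over the interval between m and n + m, which in
  characteristic two is the sum of two intervals based at 0.\<close>

lemma S_Z_left: "S n (Z m x) y = S (n + m) x y + S m x y"
proof (induction n rule: int_induct[where k = 0])
  case (step1 i)
  have "S (i + 1 + m) x y = S (i + m) x y + \<beta> (Z i (Z m x)) y"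
    using S_Suc[of "i + m" x y] by (simp add: Z_add add.commute add.left_commute)
  with step1 show ?case
    by (simp only: S_Suc[of i]) (simp add: add.assoc add.commute)
next
  case (step2 i)
  have "S (i - 1 + m) x y = S (i + m) x y + \<beta> (Z (i - 1) (Z m x)) y"
    using S_pred[of "i + m" x y] by (simp add: algebra_simps flip: Z_add)
  with step2 show ?case
    by (simp only: S_pred[of i]) (simp add: add.assoc add.commute)
qed simp

lemma S_Z_right: "S n x (Z m y) = S (n + m) x y + S m x y"
  using S_Z_left[of n m y x] by (simp add: S_sym)

text \<open>By \<open>Z_beta\<close> and additivity on the radical, g^m acts on \<open>S\<close> as
  g^(-m) on the first argument; the index shift does the rest.\<close>

lemma Z_S: "Z m (S n x y) = S (n - m) x y + S (- m) x y"
proof -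
  have "Z m (S n x y) = S n (Z (- m) x) y"
  proof (induction n rule: int_induct[where k = 0])
    case (step1 i)
    have "Z (- m) (Z i x) = Z i (Z (- m) x)"
      by (simp add: add.commute flip: Z_add)
    with step1 show ?case
      by (simp only: S_Suc[of i] Z_add_Rad beta_in_Rad Z_beta)
  next
    case (step2 i)
    have "Z (- m) (Z (i - 1) x) = Z (i - 1) (Z (- m) x)"
      by (simp add: add.commute flip: Z_add)
    with step2 show ?case
      by (simp only: S_pred[of i] Z_add_Rad beta_in_Rad Z_beta)
  qed simp
  then show ?thesis by (simp add: S_Z_left)
qed

text \<open>\<open>beta_f_Z\<close> raises the exponent of g by one in each term, so under f stands
  the sum over the interval between 1 and n + 1. All terms lie in the radical, where f is
  additive.\<close>

lemma S_f: "S n (f x) (f y) = f (S (n + 1) x y + S 1 x y)"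
proof (induction n rule: int_induct[where k = 0])
  case (step1 i)
  have "S (i + 1 + 1) x y + S 1 x y = (S (i + 1) x y + S 1 x y) + \<beta> (Z (i + 1) x) y"
    by (subst S_Suc) (simp add: algebra_simps)
  with step1 show ?case
    by (simp add: S_Suc[of i] beta_f_Z f_add_Rad Rad_add)
next
  case (step2 i)
  have "S (i - 1 + 1) x y + S 1 x y = (S (i + 1) x y + S 1 x y) + \<beta> (Z i x) y"
    using S_Suc[of i x y] by (simp add: algebra_simps)
  with step2 show ?case
    using beta_f_Z[of "i - 1" x y] by (simp add: S_pred[of i] f_add_Rad Rad_add)
qed simp

text \<open>For m = 1 this is the definition of \<open>\<beta>\<close>. The induction conjugates by
  one more f or its inverse, and \<open>S_f\<close> absorbs the change. It is the bridge between
  conjugated additions and biadditive terms.\<close>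

lemma P_conj: "P (- m) (P m x + P m y) = x + y + S m x y"
proof (induction m arbitrary: x y rule: int_induct[where k = 0])
  case (step1 i)
  have "P (- (i + 1)) (P (i + 1) x + P (i + 1) y) = inv_into UNIV f (P (- i) (P i (f x) + P i (f y)))"
    using P_add[of i 1] P_add[of "-1" "-i"] by (simp only: zpow_minus_1 zpow_1 minus_add_distrib add.commute)
  also have "\<dots> = inv_into UNIV f (f x + f y + f (S (i + 1) x y + S 1 x y))"
    by (simp add: step1 S_f)
  also have "\<dots> = inv_into UNIV f (f x + f y) + (S (i + 1) x y + S 1 x y)"
    by (simp add: inv_f_add_Rad f_Rad Rad_add)
  also have "inv_into UNIV f (f x + f y) = x + y + S 1 x y"
    using S_Suc[of 0 x y] by (simp add: assoc_beta_def)
  finally show ?case by (simp add: algebra_simps)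
next
  case (step2 i)
  define u v where "u = inv_into UNIV f x" and "v = inv_into UNIV f y"
  have x: "x = f u" and y: "y = f v" by (simp_all add: u_def v_def)
  have Pm: "P (i - 1) (f w) = P i w" for w
    using P_add[of "i - 1" 1 w] by simp
  have "P (- (i - 1)) (P (i - 1) x + P (i - 1) y) = f (P (- i) (P i u + P i v))"
    using P_add[of 1 "-i"] by (simp add: x y Pm)
  also have "\<dots> = f (u + v + S i u v)" by (simp add: step2)
  \<comment> \<open>\<open>S 1 u v\<close> equals \<open>\<beta> u v\<close>; it is inserted twice
    so that \<open>f_add_beta\<close> takes one copy and \<open>S_f\<close> the other.\<close>
  also have "u + v + S i u v = (u + v + \<beta> u v) + (S (i - 1 + 1) u v + S 1 u v)"
    using S_Suc[of 0 u v] by (simp add: algebra_simps)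
  also have "f \<dots> = x + y + S (i - 1) x y"
    by (simp only: f_add_Rad Rad_add S_Rad f_add_beta x y S_f)
  finally show ?case .
qed simp

text \<open>The failure of g^n to be additive comes from \<open>P_conj\<close> with m = -3n at the
  arguments g^n x and g^n y; index shifts bring it back to x and y.\<close>

lemma Z_distrib: "Z n (x + y) = Z n x + Z n y + S (- n) x y + S (2 * n) x y"
  using P_conj[of "- 3 * n" "Z n x" "Z n y"] P_add[of "-3 * n" "3 * n"]
  by (simp add: Z_P[symmetric] S_Z_left S_Z_right)

text \<open>The X-coordinate of a product in the semidirect product, with arbitrary integers i and j
  in place of the chosen logarithms.\<close>

definition F :: "int \<Rightarrow> int \<Rightarrow> 'x \<Rightarrow> 'x \<Rightarrow> 'x" where
  "F i j x y = Z (- j) x + y + (\<Sum>k\<in>Iset (i + j) (- j). Z (- k) (\<beta> x y))"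

lemma F_eq: "F i j x y = Z (- j) x + y + (S (i + j) x y + S (- j) x y)"
proof -
  have "(\<Sum>k\<in>Iset (i + j) (- j). Z (- k) (\<beta> x y)) = (\<Sum>k\<in>Iset (i + j) (- j). \<beta> (Z k x) y)"
    by (simp add: Z_beta)
  also have "\<dots> = S (i + j) x y + S (- j) x y"
    unfolding S_def by (rule sum_Iset) simp
  finally show ?thesis by (simp add: F_def)
qed

text \<open>\<open>P_conj\<close> with m = i + 2j at the arguments g^(-j) x and y. This identifies
  the semidirect multiplication with the formula forced in a Moufang loop.\<close>

lemma F_conj: "F i j x y = P (- i - 2 * j) (P (i - j) x + P (i + 2 * j) y)"
proof -
  have "P (- (i + 2 * j)) (P (i + 2 * j) (Z (- j) x) + P (i + 2 * j) y) = F i j x y"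
    unfolding P_conj F_eq by (simp add: S_Z_left algebra_simps)
  moreover have "P (i + 2 * j) (Z (- j) x) = P (i - j) x"
    using P_add[of "i + 2 * j" "- 3 * j" x] by (simp add: Z_P algebra_simps)
  ultimately show ?thesis by (simp add: algebra_simps)
qed

text \<open>Fully expanded, both sides consist of the same powers of g on x, y, z and of terms
  \<open>S n\<close> in two of the three variables; nested terms vanish because \<open>S\<close>
  takes values in the radical. Repeated terms cancel, and the last pass writes integer indices
  without subtraction so that equal terms also look equal.\<close>

lemma F_moufang:
  "F (i + j) (l + i) (F i j x y) (F l i z x) = F (i + (j + l)) i (F i (j + l) x (F j l y z)) x"
proof -
  have Sn: "S n y x = S n x y" "S n z x = S n x z" "S n z y = S n y z" for n
    by (simp_all add: S_sym)
  show ?thesis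
    unfolding F_eq
    by (simp add: Z_add_Rad Rad_add Z_distrib S_add_left S_add_right S_Z_left S_Z_right Z_S Sn
          flip: Z_add,
        simp add: algebra_simps,
        simp only: diff_conv_add_uminus minus_add_distrib minus_minus ac_simps)
qed

end

section \<open>Moufang permutations from the Moufang identity\<close>

locale moufang_powers =
  fixes f :: "'x::ab_group_add \<Rightarrow> 'x" and M :: "int \<Rightarrow> int \<Rightarrow> 'x \<Rightarrow> 'x \<Rightarrow> 'x"
  assumes bij_f: "bij f" and f_0 [simp]: "f 0 = 0"
    and M_eq: "M i j x y = zpow f (- i - 2 * j) (zpow f (i - j) x + zpow f (i + 2 * j) y)"
    and M_moufang:
      "M (i + j) (l + i) (M i j x y) (M l i z x) = M (i + (j + l)) i (M i (j + l) x (M j l y z)) x"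
begin

abbreviation "P \<equiv> zpow f"

text \<open>The addition of X transported along f^m, hence for every m an abelian group operation
  with neutral element 0.\<close>

definition op :: "int \<Rightarrow> 'x \<Rightarrow> 'x \<Rightarrow> 'x" where
  "op m x y = P (- m) (P m x + P m y)"

text \<open>The defect of \<open>op m\<close> from addition; \<open>B 1\<close> is the mapping
  associated with f.\<close>

definition B :: "int \<Rightarrow> 'x \<Rightarrow> 'x \<Rightarrow> 'x" where
  "B m x y = op m x y - x - y"

lemma P_add: "P (i + j) x = P i (P j x)"
  by (rule zpow_add[OF bij_f])

lemma P_P: "P i (P j x) = P (i + j) x"
  by (simp add: P_add)

lemma P_0 [simp]: "P k 0 = 0"
proof (induction k rule: int_induct[where k = 0])
  case (step2 i)
  then show ?case
    by (simp add: zpow_pred[OF bij_f]) (metis bij_f bij_is_inj f_0 inv_f_f)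
qed (simp_all add: zpow_Suc[OF bij_f])

lemma op_eq: "op m x y = x + y + B m x y"
  by (simp add: B_def algebra_simps)

lemma op_commute: "op m x y = op m y x"
  by (simp add: op_def add.commute)

lemma op_assoc: "op m (op m x y) z = op m x (op m y z)"
  by (simp add: op_def bij_f add.assoc)

lemma op_0 [simp]: "op 0 x y = x + y" "op m x 0 = x" "op m 0 x = x"
  by (simp_all add: op_def bij_f)

lemma op_cancel: "op m x y = op m x z \<longleftrightarrow> y = z"
  by (simp add: op_def zpow_inj bij_f)

lemma P_op: "P k (op m x y) = op (m - k) (P k x) (P k y)"
  by (simp add: op_def P_P)

lemma M_op: "M i j x y = op (i + 2 * j) (P (- 3 * j) x) y"
  unfolding M_eq op_def by (simp add: P_P algebra_simps)

section \<open>Biadditivity of the defects from the Moufang identity\<close>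

text \<open>The case i = 0 of the Moufang identity. After x is replaced by f^(3p) u and y by f^(3l)
  y, the other two exponents enter only through p = j + l and m = j + 2l, an arbitrary pair of
  integers.\<close>

lemma op_moufang:
  "op m (op (m + p) u y) (op (m - p) z (P (3 * p) u))
     = op p (op (2 * p) u (op m y z)) (P (3 * p) u)"
proof -
  define l where "l = m - p"
  have m: "m = l + p" by (simp add: l_def)
  show ?thesis
    using M_moufang[of 0 "p - l" l "P (3 * p) u" "P (3 * l) y" z]
    by (simp add: M_op P_op P_P m algebra_simps)
qed

text \<open>For z = 0 the right side of \<open>op_moufang\<close> does not depend on m, so it can be
  evaluated at m = 0, where the outer operation on the left is addition.\<close>

lemma op_moufang_left: "op m (op (m + p) u y) (P (3 * p) u) = op p u y + P (3 * p) u"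
  using op_moufang[of m p u y 0] op_moufang[of 0 p u y 0] by simp

lemma op_moufang_right: "op m u (op (m - p) z (P (3 * p) u)) = op p u z + P (3 * p) u"
  using op_moufang[of m p u 0 z] op_moufang[of 0 p u z 0] by simp

lemma B_0 [simp]: "B m 0 x = 0" "B m x 0 = 0" "B 0 x y = 0"
  by (simp_all add: B_def)

lemma B_sym: "B m x y = B m y x"
  by (simp add: B_def op_commute algebra_simps)

text \<open>At m = 0 the right side of \<open>op_moufang\<close> sees y and z only through y + z, so
  the pair (y, z) may be replaced by (y + z, 0). The summand containing z is evaluated by
  \<open>op_moufang_right\<close>.\<close>

lemma B_add_right: "B p u (y + z) = B p u y + B p u z"
proof -
  define x where "x = P (3 * p) u"
  have "op p u y + op (- p) z x = op p u (y + z) + x"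
    using op_moufang[of 0 p u y z] op_moufang[of 0 p u "y + z" 0] by (simp add: x_def)
  moreover have "op (- p) z x = op p u z + x - u"
    using op_moufang_right[of 0 u p z] by (simp add: x_def eq_diff_eq add.commute)
  ultimately have "op p u y + op p u z = u + op p u (y + z)"
    by (simp add: algebra_simps)
  then show ?thesis by (simp add: op_eq algebra_simps)
qed

lemma B_add_left: "B p (y + z) u = B p y u + B p z u"
  using B_add_right[of p u y z] by (simp add: B_sym)

lemma B_alt [simp]: "B m u u = 0"
  using op_moufang_left[of m 0 u 0] by (simp add: op_eq)

lemma B_two [simp]: "B m u v + B m u v = 0"
proof -
  have "B m (u + v) (u + v) = B m u v + B m v u"
    by (simp only: B_add_left B_add_right) simp
  then show ?thesis using B_sym[of m u v] by simp
qed

text \<open>In \<open>op_moufang_right\<close> with m = p and z = 0 both inner operations become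
  trivial.\<close>

lemma B_P3 [simp]: "B p u (P (3 * p) u) = 0"
  using op_moufang_right[of p u p 0] by (simp add: op_eq)

text \<open>For p = 0, \<open>op_moufang_left\<close> equates a double \<open>op m\<close> with a
  plain sum. On expansion the two copies of \<open>B m u y\<close> cancel and the nested term is
  left.\<close>

lemma B_B_same [simp]: "B m u (B m u y) = 0"
proof -
  have "op m (op m u y) u = op 0 u y + u"
    using op_moufang_left[of m 0 u y] by simp
  then have "B m u y + (B m u y + B m u (B m u y)) = 0"
    by (simp add: op_eq B_add_left B_sym[of m _ u] algebra_simps)
  then show ?thesis by (simp flip: add.assoc)
qed

lemma eq_of_add_zero: "a + b = 0 \<Longrightarrow> b + b = 0 \<Longrightarrow> a = (b::'x)"
  by (metis add_right_cancel)

text \<open>Linearization of \<open>B_B_same\<close> in u; signs do not matter because of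
  \<open>B_two\<close>.\<close>

lemma B_B_swap: "B m u (B m v y) = B m v (B m u y)"
proof -
  have "B m (u + v) (B m (u + v) y) = 0" by simp
  then have "B m u (B m v y) + B m v (B m u y) = 0"
    by (simp only: B_add_left B_add_right B_B_same) (simp add: add.commute)
  then show ?thesis by (rule eq_of_add_zero) simp
qed

text \<open>Symmetry combined with the swap rule. Each \<open>B m\<close> is thus the product of a
  commutative associative ring on X in which all squares vanish.\<close>

lemma B_assoc: "B m (B m x y) z = B m x (B m y z)"
  using B_B_swap[of m z x y] by (simp only: B_sym[of m _ z] B_sym[of m y z])

text \<open>The last axiom of a Moufang permutation with f moved to the other side. The element
  \<open>\<alpha>\<close> is found by rewriting \<open>op 2 u y\<close> through \<open>op 1\<close>,
  inserting it into \<open>op_moufang_left\<close> with m = p = 1, and cancelling in the group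
  \<open>op 1\<close>.\<close>

lemma conj_f_B: "inv_into UNIV f (B 1 (f u) (f y)) = B 1 (P 3 u) y"
proof -
  define x \<alpha> s where "x = P 3 u" and "\<alpha> = inv_into UNIV f (B 1 (f u) (f y))" and "s = op 1 u y"
  have f_op: "f (op 1 v w) = f v + f w" for v w
    using P_op[of 1 1 v w] by simp
  have "f (op 2 u y) = op 1 (f u) (f y)"
    using P_op[of 1 2 u y] by simp
  \<comment> \<open>f carries \<open>op 1\<close> to addition, so the defect of \<open>op 1\<close>
    at \<open>f u\<close> and \<open>f y\<close> turns into the factor \<open>\<alpha>\<close> of
    \<open>op 1\<close>.\<close>
  also have "\<dots> = f (op 1 s \<alpha>)"
    using bij_f by (simp add: f_op op_eq[of 1 "f u"] s_def \<alpha>_def bij_is_surj surj_f_inv_f)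
  finally have "op 2 u y = op 1 s \<alpha>"
    using bij_f by (simp add: bij_is_inj inj_eq)
  then have "op 1 (op 1 s \<alpha>) x = s + x"
    using op_moufang_left[of 1 1 u y] by (simp add: x_def s_def)
  then have "op 1 (op 1 s x) \<alpha> = s + x"
    by (metis op_assoc op_commute)
  also have "s + x = op 1 (op 1 s x) (B 1 s x)"
  proof -
    have "B 1 x (B 1 s x) = 0" by (subst B_sym[of 1 s]) simp
    then have "B 1 (op 1 s x) (B 1 s x) = 0"
      by (simp add: op_eq[of 1 s] B_add_left)
    then show ?thesis
      by (simp add: op_eq[of 1 "op 1 s x"]) (simp add: op_eq add.assoc)
  qed
  finally have "\<alpha> = B 1 s x" by (simp only: op_cancel)
  \<comment> \<open>Of the three summands of s only y survives: u is killed by \<open>B_P3\<close>,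
    and \<open>B 1 u y\<close> by associativity.\<close>
  also have "\<dots> = B 1 x y"
  proof -
    have ux: "B 1 u x = 0" using B_P3[of 1 u] by (simp add: x_def)
    have "B 1 (B 1 u y) x = B 1 (B 1 y u) x" by (simp only: B_sym)
    also have "\<dots> = 0" by (simp add: B_assoc ux)
    finally show ?thesis
      using ux by (simp add: s_def op_eq B_add_left B_sym[of 1 y x])
  qed
  finally show ?thesis by (simp add: x_def \<alpha>_def)
qed

text \<open>By \<open>conj_f_B\<close>, \<open>B 1 w\<close> is the conjugate under f of the
  additive map \<open>B 1 (f u)\<close>, hence an endomorphism of \<open>op 1\<close> as well as of
  addition. Comparison on \<open>op 1 y z\<close> gives w(yz) = (wy)(wz) in the ring, and the right
  side has w as a repeated factor.\<close>

lemma B_nilpotent [simp]: "B 1 w (B 1 y z) = 0"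
proof -
  define u where "u = P (- 3) w"
  have w: "w = P 3 u" by (simp add: u_def P_P)
  have f_op: "f (op 1 v w) = f v + f w" for v w
    using P_op[of 1 1 v w] by simp
  have finv: "f (inv_into UNIV f v) = v" for v
    using bij_f by (simp add: bij_is_surj surj_f_inv_f)
  have "B 1 (f u) (f (op 1 y z)) = B 1 (f u) (f y) + B 1 (f u) (f z)"
    by (simp add: f_op B_add_right)
  then have "f (B 1 w (op 1 y z)) = f (op 1 (B 1 w y) (B 1 w z))"
    unfolding w f_op conj_f_B[symmetric] finv .
  then have "B 1 w (op 1 y z) = op 1 (B 1 w y) (B 1 w z)"
    using bij_f by (simp add: bij_is_inj inj_eq)
  then have "B 1 w (B 1 y z) = B 1 (B 1 w y) (B 1 w z)"
    by (simp add: op_eq B_add_right)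
  also have "\<dots> = B 1 w (B 1 w (B 1 y z))"
    by (simp only: B_assoc B_B_swap[of 1 y w z])
  finally show ?thesis by simp
qed

lemma assoc_beta_B: "assoc_beta f x y = B 1 x y"
  by (simp add: assoc_beta_def B_def op_def zpow_minus_1)

lemma moufang_perm_f: "moufang_perm f"
  unfolding moufang_perm_def assoc_beta_B
proof (intro conjI allI)
  show "B 1 (f x) (f y) = f (B 1 ((f ^^ 3) x) y)" for x y
    using conj_f_B[of x y] zpow_of_nat[of f 3 x] bij_f
    by (metis bij_is_surj of_nat_numeral surj_f_inv_f)
  show "B 1 (B 1 x y) z = 0" for x y z
    using B_nilpotent B_sym by metis
qed (auto simp: bij_f B_add_left B_add_right intro: B_sym)

end

section \<open>Moufang loops\<close>

locale moufang =
  fixes Q (structure)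
  assumes moufang_loop: "moufang_loop Q"
begin

lemma loop: "loop Q"
  using moufang_loop by (simp add: moufang_loop_def)

lemma one_closed [simp]: "\<one> \<in> carrier Q"
  and m_closed [simp]: "x \<in> carrier Q \<Longrightarrow> y \<in> carrier Q \<Longrightarrow> x \<otimes> y \<in> carrier Q"
  and l_one [simp]: "x \<in> carrier Q \<Longrightarrow> \<one> \<otimes> x = x"
  and r_one [simp]: "x \<in> carrier Q \<Longrightarrow> x \<otimes> \<one> = x"
  using loop by (simp_all add: loop_def)

lemma ex1_left_div: "a \<in> carrier Q \<Longrightarrow> c \<in> carrier Q \<Longrightarrow> \<exists>!x. x \<in> carrier Q \<and> a \<otimes> x = c"
  and ex1_right_div: "a \<in> carrier Q \<Longrightarrow> c \<in> carrier Q \<Longrightarrow> \<exists>!y. y \<in> carrier Q \<and> y \<otimes> a = c"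
  using loop by (simp_all add: loop_def)

lemma l_cancel:
  assumes "x \<in> carrier Q" "y \<in> carrier Q" "z \<in> carrier Q"
  shows "x \<otimes> y = x \<otimes> z \<longleftrightarrow> y = z"
  using ex1_left_div[of x "x \<otimes> z"] assms by auto

lemma r_cancel:
  assumes "x \<in> carrier Q" "y \<in> carrier Q" "z \<in> carrier Q"
  shows "y \<otimes> x = z \<otimes> x \<longleftrightarrow> y = z"
  using ex1_right_div[of x "z \<otimes> x"] assms by auto

lemma moufang:
  "x \<in> carrier Q \<Longrightarrow> y \<in> carrier Q \<Longrightarrow> z \<in> carrier Q
    \<Longrightarrow> (x \<otimes> y) \<otimes> (z \<otimes> x) = (x \<otimes> (y \<otimes> z)) \<otimes> x"
  using moufang_loop by (simp add: moufang_loop_def)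

lemma flexible:
  "x \<in> carrier Q \<Longrightarrow> z \<in> carrier Q \<Longrightarrow> x \<otimes> (z \<otimes> x) = (x \<otimes> z) \<otimes> x"
  using moufang[of x \<one> z] by simp

text \<open>With x' for y the left side of the Moufang identity collapses to z x, and the right
  factor x cancels.\<close>

lemma right_inverse_left:
  assumes "x \<in> carrier Q" "x' \<in> carrier Q" "x \<otimes> x' = \<one>" "z \<in> carrier Q"
  shows "x \<otimes> (x' \<otimes> z) = z"
  using moufang[of x x' z] assms by (simp add: r_cancel)

lemma right_inverse_is_left:
  assumes "x \<in> carrier Q" "x' \<in> carrier Q" "x \<otimes> x' = \<one>"
  shows "x' \<otimes> x = \<one>"
  using right_inverse_left[OF assms assms(1)] assms l_cancel[of x "x' \<otimes> x" \<one>] by simp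

text \<open>\<open>m_inv\<close> is a definite description, so existence and uniqueness of a
  two-sided inverse have to be established before anything about \<open>inv\<close> can be
  derived.\<close>

lemma inv_props:
  assumes x: "x \<in> carrier Q"
  shows "inv x \<in> carrier Q \<and> x \<otimes> inv x = \<one> \<and> inv x \<otimes> x = \<one>"
proof -
  obtain x' where x': "x' \<in> carrier Q" "x \<otimes> x' = \<one>"
    using ex1_left_div[OF x one_closed] by blast
  have "inv x = x'"
    unfolding m_inv_def
  proof (rule the_equality)
    show "x' \<in> carrier Q \<and> x \<otimes> x' = \<one> \<and> x' \<otimes> x = \<one>"
      using x x' right_inverse_is_left by blast
    show "y = x'" if "y \<in> carrier Q \<and> x \<otimes> y = \<one> \<and> y \<otimes> x = \<one>" for y
      using that x x' l_cancel[of x y x'] by simp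
  qed
  with x x' right_inverse_is_left show ?thesis by simp
qed

lemma inv_closed [simp]: "x \<in> carrier Q \<Longrightarrow> inv x \<in> carrier Q"
  and r_inv [simp]: "x \<in> carrier Q \<Longrightarrow> x \<otimes> inv x = \<one>"
  and l_inv [simp]: "x \<in> carrier Q \<Longrightarrow> inv x \<otimes> x = \<one>"
  using inv_props by auto

lemma inv_unique: "x \<in> carrier Q \<Longrightarrow> y \<in> carrier Q \<Longrightarrow> x \<otimes> y = \<one> \<Longrightarrow> inv x = y"
  using l_cancel[of x y "inv x"] by simp

lemma inv_inv [simp]: "x \<in> carrier Q \<Longrightarrow> inv (inv x) = x"
  by (rule inv_unique) simp_all

lemma left_inv_prop [simp]:
  "x \<in> carrier Q \<Longrightarrow> y \<in> carrier Q \<Longrightarrow> x \<otimes> (inv x \<otimes> y) = y"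
  "x \<in> carrier Q \<Longrightarrow> y \<in> carrier Q \<Longrightarrow> inv x \<otimes> (x \<otimes> y) = y"
  using right_inverse_left[of x "inv x" y] right_inverse_left[of "inv x" x y] by simp_all

lemma right_inv_prop [simp]:
  assumes "x \<in> carrier Q" "y \<in> carrier Q"
  shows "(y \<otimes> inv x) \<otimes> x = y" "(y \<otimes> x) \<otimes> inv x = y"
proof -
  have *: "(y \<otimes> inv x) \<otimes> x = y" if xy: "x \<in> carrier Q" "y \<in> carrier Q" for x y
  proof -
    have "x \<otimes> y = x \<otimes> ((y \<otimes> inv x) \<otimes> x)"
      using moufang[of x y "inv x"] xy by (simp add: flexible)
    then show ?thesis using xy by (simp add: l_cancel)
  qed
  show "(y \<otimes> inv x) \<otimes> x = y" using * assms by simp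
  show "(y \<otimes> x) \<otimes> inv x = y" using *[of "inv x" y] assms by simp
qed

lemma inv_mult:
  assumes "x \<in> carrier Q" "y \<in> carrier Q"
  shows "inv (x \<otimes> y) = inv y \<otimes> inv x"
proof -
  have "inv x = y \<otimes> inv (x \<otimes> y)"
    using left_inv_prop(2)[of x "y"] right_inv_prop(2)[of "x \<otimes> y" "inv x"] assms by simp
  then show ?thesis
    using left_inv_prop(2)[of y "inv (x \<otimes> y)"] assms by simp
qed

text \<open>The Moufang identity with y = r s and z = s^(-1), the factor s^(-1) a then being moved
  to the other side.\<close>

lemma moufang_left_autotopism:
  assumes "a \<in> carrier Q" "r \<in> carrier Q" "s \<in> carrier Q"
  shows "((a \<otimes> r) \<otimes> a) \<otimes> (inv a \<otimes> s) = a \<otimes> (r \<otimes> s)"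
proof -
  have "(a \<otimes> (r \<otimes> s)) \<otimes> (inv s \<otimes> a) = (a \<otimes> r) \<otimes> a"
    using moufang[of a "r \<otimes> s" "inv s"] assms by simp
  then have "((a \<otimes> r) \<otimes> a) \<otimes> inv (inv s \<otimes> a) = a \<otimes> (r \<otimes> s)"
    using right_inv_prop(2)[of "inv s \<otimes> a" "a \<otimes> (r \<otimes> s)"] assms by simp
  then show ?thesis using assms by (simp add: inv_mult)
qed

text \<open>The Moufang identity at a with y = p^(-1) and z = p r, the factor a p^(-1) then being
  moved to the other side.\<close>

lemma moufang_right_autotopism:
  assumes "a \<in> carrier Q" "p \<in> carrier Q" "r \<in> carrier Q"
  shows "(p \<otimes> inv a) \<otimes> ((a \<otimes> r) \<otimes> a) = (p \<otimes> r) \<otimes> a"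
proof -
  have "(a \<otimes> inv p) \<otimes> ((p \<otimes> r) \<otimes> a) = (a \<otimes> r) \<otimes> a"
    using moufang[of a "inv p" "p \<otimes> r"] assms by simp
  then have "inv (a \<otimes> inv p) \<otimes> ((a \<otimes> r) \<otimes> a) = (p \<otimes> r) \<otimes> a"
    using left_inv_prop(2)[of "a \<otimes> inv p" "(p \<otimes> r) \<otimes> a"] assms by simp
  then show ?thesis using assms by (simp add: inv_mult)
qed

lemma left_moufang:
  assumes "a \<in> carrier Q" "r \<in> carrier Q" "v \<in> carrier Q"
  shows "a \<otimes> (r \<otimes> (a \<otimes> v)) = ((a \<otimes> r) \<otimes> a) \<otimes> v"
  using moufang_left_autotopism[of a r "a \<otimes> v"] assms by simp

end

section \<open>Left, right and conjugation actions of a cyclic group on a Moufang loop\<close>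

locale moufang_cyclic = moufang Q + C: group C
  for Q (structure) and C (structure) +
  fixes \<psi> and a
  assumes \<psi>_closed [simp]: "c \<in> carrier C \<Longrightarrow> \<psi> c \<in> carrier Q"
    and \<psi>_mult: "c \<in> carrier C \<Longrightarrow> d \<in> carrier C \<Longrightarrow> \<psi> (c \<otimes>\<^bsub>C\<^esub> d) = \<psi> c \<otimes>\<^bsub>Q\<^esub> \<psi> d"
    and a_closed [simp]: "a \<in> carrier C"
    and cyclic: "\<And>c. c \<in> carrier C \<Longrightarrow> \<exists>n::nat. c = a [^]\<^bsub>C\<^esub> n"
begin

lemma \<psi>_one [simp]: "\<psi> \<one>\<^bsub>C\<^esub> = \<one>\<^bsub>Q\<^esub>"
  using \<psi>_mult[of "\<one>\<^bsub>C\<^esub>" "\<one>\<^bsub>C\<^esub>"] l_cancel[of "\<psi> \<one>\<^bsub>C\<^esub>" "\<psi> \<one>\<^bsub>C\<^esub>" "\<one>\<^bsub>Q\<^esub>"] by simp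

lemma \<psi>_inv: "c \<in> carrier C \<Longrightarrow> \<psi> (inv\<^bsub>C\<^esub> c) = inv\<^bsub>Q\<^esub> (\<psi> c)"
  by (rule inv_unique[symmetric]) (simp_all flip: \<psi>_mult)

lemma comm: "c \<in> carrier C \<Longrightarrow> d \<in> carrier C \<Longrightarrow> c \<otimes>\<^bsub>C\<^esub> d = d \<otimes>\<^bsub>C\<^esub> c"
  using cyclic[of c] cyclic[of d] by (auto simp: C.nat_pow_mult add.commute)

lemma left_pow: "x \<in> carrier Q \<Longrightarrow> \<psi> (a [^]\<^bsub>C\<^esub> (n::nat)) \<otimes> x = ((\<lambda>y. \<psi> a \<otimes> y) ^^ n) x"
\<comment> \<open>Steps of two, because \<open>left_moufang\<close> handles a power in the symmetric
  form a a^n a.\<close>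
proof (induction n arbitrary: x rule: induct_nat_012)
  case (ge2 n)
  have "a [^]\<^bsub>C\<^esub> Suc (Suc n) = a \<otimes>\<^bsub>C\<^esub> a [^]\<^bsub>C\<^esub> n \<otimes>\<^bsub>C\<^esub> a"
    by (simp add: comm C.m_assoc)
  then have "\<psi> (a [^]\<^bsub>C\<^esub> Suc (Suc n)) \<otimes> x = ((\<psi> a \<otimes> \<psi> (a [^]\<^bsub>C\<^esub> n)) \<otimes> \<psi> a) \<otimes> x"
    by (simp only: \<psi>_mult C.nat_pow_closed a_closed C.m_closed)
  also have "\<dots> = \<psi> a \<otimes> (\<psi> (a [^]\<^bsub>C\<^esub> n) \<otimes> (\<psi> a \<otimes> x))"
    using ge2.prems by (simp add: left_moufang)
  also have "\<dots> = \<psi> a \<otimes> ((\<lambda>y. \<psi> a \<otimes> y) ^^ Suc n) x"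
    using ge2 by (simp add: funpow_swap1)
  finally show ?case by simp
qed simp_all

lemma left_act:
  assumes "c \<in> carrier C" "d \<in> carrier C" "x \<in> carrier Q"
  shows "\<psi> c \<otimes> (\<psi> d \<otimes> x) = \<psi> (c \<otimes>\<^bsub>C\<^esub> d) \<otimes> x"
proof -
  obtain m n :: nat where "c = a [^]\<^bsub>C\<^esub> m" "d = a [^]\<^bsub>C\<^esub> n"
    using cyclic assms by metis
  moreover have "((\<lambda>y. \<psi> a \<otimes> y) ^^ n) x \<in> carrier Q"
    using left_pow[of x n] assms by (metis m_closed \<psi>_closed C.nat_pow_closed a_closed)
  ultimately show ?thesis
    using assms by (simp add: left_pow C.nat_pow_mult funpow_add)
qed

text \<open>Inversion reverses products and thereby carries the right action to the left
  one.\<close>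

lemma right_act:
  assumes "c \<in> carrier C" "d \<in> carrier C" "x \<in> carrier Q"
  shows "(x \<otimes> \<psi> c) \<otimes> \<psi> d = x \<otimes> \<psi> (c \<otimes>\<^bsub>C\<^esub> d)"
proof -
  have "inv\<^bsub>Q\<^esub> ((x \<otimes> \<psi> c) \<otimes> \<psi> d) = inv\<^bsub>Q\<^esub> (x \<otimes> \<psi> (c \<otimes>\<^bsub>C\<^esub> d))"
    using assms by (simp add: inv_mult left_act C.inv_mult_group add.commute flip: \<psi>_inv)
  then show ?thesis
    using assms by (metis inv_inv m_closed \<psi>_closed C.m_closed)
qed

text \<open>Flexibility lets one left factor a pass one right factor a; induction on each exponent
  does the rest. Hence the bracketing chosen in \<open>cj\<close> is immaterial.\<close>

lemma bi_act:
  assumes "c \<in> carrier C" "d \<in> carrier C" "x \<in> carrier Q"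
  shows "\<psi> c \<otimes> (x \<otimes> \<psi> d) = (\<psi> c \<otimes> x) \<otimes> \<psi> d"
proof -
  have 1: "\<psi> a \<otimes> (x \<otimes> \<psi> (a [^]\<^bsub>C\<^esub> (n::nat))) = (\<psi> a \<otimes> x) \<otimes> \<psi> (a [^]\<^bsub>C\<^esub> n)"
    if "x \<in> carrier Q" for x n
  proof (induction n)
    case (Suc n)
    have "\<psi> a \<otimes> (x \<otimes> \<psi> (a [^]\<^bsub>C\<^esub> Suc n)) = \<psi> a \<otimes> ((x \<otimes> \<psi> (a [^]\<^bsub>C\<^esub> n)) \<otimes> \<psi> a)"
      using that by (simp add: right_act)
    also have "\<dots> = ((\<psi> a \<otimes> x) \<otimes> \<psi> (a [^]\<^bsub>C\<^esub> n)) \<otimes> \<psi> a"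
      using that Suc by (simp add: flexible)
    also have "\<dots> = (\<psi> a \<otimes> x) \<otimes> \<psi> (a [^]\<^bsub>C\<^esub> Suc n)"
      using that by (simp add: right_act)
    finally show ?case .
  qed (use that in simp)
  obtain m n :: nat where c: "c = a [^]\<^bsub>C\<^esub> m" and d: "d = a [^]\<^bsub>C\<^esub> n"
    using cyclic assms by metis
  have "\<psi> (a [^]\<^bsub>C\<^esub> m) \<otimes> (x \<otimes> \<psi> d) = (\<psi> (a [^]\<^bsub>C\<^esub> m) \<otimes> x) \<otimes> \<psi> d"
  proof (induction m)
    case (Suc m)
    have "\<psi> (a [^]\<^bsub>C\<^esub> Suc m) \<otimes> y = \<psi> a \<otimes> (\<psi> (a [^]\<^bsub>C\<^esub> m) \<otimes> y)" if "y \<in> carrier Q" for y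
      using that by (simp add: left_act comm)
    with Suc show ?case
      using assms 1[of "\<psi> (a [^]\<^bsub>C\<^esub> m) \<otimes> x" n] by (simp add: d)
  qed (use assms in simp)
  then show ?thesis by (simp add: c)
qed

definition cj :: "_ \<Rightarrow> _ \<Rightarrow> _" where
  "cj c x = (\<psi> c \<otimes> x) \<otimes> \<psi> (inv\<^bsub>C\<^esub> c)"

lemma cj_closed [simp]: "c \<in> carrier C \<Longrightarrow> x \<in> carrier Q \<Longrightarrow> cj c x \<in> carrier Q"
  by (simp add: cj_def)

lemma cj_cj:
  "c \<in> carrier C \<Longrightarrow> d \<in> carrier C \<Longrightarrow> x \<in> carrier Q \<Longrightarrow> cj c (cj d x) = cj (c \<otimes>\<^bsub>C\<^esub> d) x"
  by (simp add: cj_def bi_act left_act right_act C.inv_mult_group)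

lemma cj_one [simp]: "x \<in> carrier Q \<Longrightarrow> cj \<one>\<^bsub>C\<^esub> x = x"
  by (simp add: cj_def)

lemma cj_Q_one [simp]: "c \<in> carrier C \<Longrightarrow> cj c \<one>\<^bsub>Q\<^esub> = \<one>\<^bsub>Q\<^esub>"
  by (simp add: cj_def flip: \<psi>_mult)

abbreviation A :: "int \<Rightarrow> _" where "A k \<equiv> a [^]\<^bsub>C\<^esub> k"

lemma A_closed [simp]: "A k \<in> carrier C"
  by simp

lemma A_mult: "A i \<otimes>\<^bsub>C\<^esub> A j = A (i + j)"
  by (simp add: C.int_pow_mult)

lemma A_inv: "inv\<^bsub>C\<^esub> (A i) = A (- i)"
  by (simp add: C.int_pow_neg)

text \<open>
  The exponents of \<open>c\<close> and \<open>d\<close> below solve \<open>2q - r = -3i\<close>, \<open>2r - q = -3j\<close>: the two autotopisms then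
  cancel the powers of \<open>a\<close> in both factors.
\<close>

lemma mult_formula:
  assumes x: "x \<in> carrier Q" and y: "y \<in> carrier Q"
  shows "(\<psi> (A (3 * i)) \<otimes> x) \<otimes> (\<psi> (A (3 * j)) \<otimes> y)
    = \<psi> (A (3 * (i + j))) \<otimes> cj (A (- i - 2 * j)) (cj (A (i - j)) x \<otimes> cj (A (i + 2 * j)) y)"
proof -
  define c d where "c = A (- 2 * i - j)" and "d = A (- i - 2 * j)"
  define u v where "u = \<psi> (A (3 * i)) \<otimes> x" and "v = \<psi> (A (3 * j)) \<otimes> y"
  have cd [simp]: "c \<in> carrier C" "d \<in> carrier C" and uv [simp]: "u \<in> carrier Q" "v \<in> carrier Q"
    using x y by (simp_all add: c_def d_def u_def v_def)
  define w where "w = cj (A (i - j)) x \<otimes> cj (A (i + 2 * j)) y"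
  have w [simp]: "w \<in> carrier Q" using x y by (simp add: w_def)
  have "\<psi> c \<otimes> ((u \<otimes> v) \<otimes> \<psi> d)
      = ((\<psi> c \<otimes> (u \<otimes> inv\<^bsub>Q\<^esub> (\<psi> d))) \<otimes> \<psi> c) \<otimes> (inv\<^bsub>Q\<^esub> (\<psi> c) \<otimes> ((\<psi> d \<otimes> v) \<otimes> \<psi> d))"
    by (simp add: moufang_left_autotopism moufang_right_autotopism)
  also have "(\<psi> c \<otimes> (u \<otimes> inv\<^bsub>Q\<^esub> (\<psi> d))) \<otimes> \<psi> c = cj (A (i - j)) x"
    using x by (simp add: u_def cj_def bi_act left_act right_act c_def d_def A_mult A_inv add.commute flip: \<psi>_inv)
  also have "inv\<^bsub>Q\<^esub> (\<psi> c) \<otimes> ((\<psi> d \<otimes> v) \<otimes> \<psi> d) = cj (A (i + 2 * j)) y"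
    using y by (simp add: v_def cj_def bi_act left_act right_act c_def d_def A_mult A_inv add.commute flip: \<psi>_inv)
  finally have "\<psi> c \<otimes> ((u \<otimes> v) \<otimes> \<psi> d) = w" by (simp add: w_def)
  then have "u \<otimes> v = (inv\<^bsub>Q\<^esub> (\<psi> c) \<otimes> w) \<otimes> inv\<^bsub>Q\<^esub> (\<psi> d)"
    using right_inv_prop(2)[of "\<psi> d" "u \<otimes> v"] left_inv_prop(2)[of "\<psi> c" "(u \<otimes> v) \<otimes> \<psi> d"] by simp
  also have "\<dots> = \<psi> (A (3 * (i + j))) \<otimes> cj (A (- i - 2 * j)) w"
    by (simp add: cj_def bi_act left_act c_def d_def A_mult A_inv add.commute flip: \<psi>_inv)
  finally show ?thesis by (simp add: u_def v_def w_def)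
qed

end

section \<open>Orders and periods\<close>

text \<open>Common to the order of a permutation and the index r, both least positive periods of a
  set closed under subtraction. That the minimum is nonzero is recorded because 0 encodes
  infinity.\<close>

lemma Least_period_dvd:
  fixes n :: nat
  assumes "0 < n" "A n" and diff: "\<And>k l. A k \<Longrightarrow> A l \<Longrightarrow> l \<le> k \<Longrightarrow> A (k - l)"
  shows "(LEAST m. 0 < m \<and> A m) \<noteq> 0" "(LEAST m. 0 < m \<and> A m) dvd n"
proof -
  define d where "d = (LEAST m. 0 < m \<and> A m)"
  have d: "0 < d \<and> A d"
    unfolding d_def by (rule LeastI[where k = n]) (use assms in auto)
  have least: "d \<le> m" if "0 < m" "A m" for m
    unfolding d_def by (rule Least_le) (use that in auto)
  have "A m \<Longrightarrow> d dvd m" for m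
  proof (induction m rule: less_induct)
    case (less m)
    show ?case
    proof (cases "m = 0")
      case False
      then have dm: "d \<le> m" using least less.prems by simp
      then have "A (m - d)" using diff less.prems d by blast
      then have "d dvd m - d" using less.IH[of "m - d"] False d by simp
      then show ?thesis using dm by (simp add: dvd_minus_self)
    qed simp
  qed
  then show "(LEAST m. 0 < m \<and> A m) \<noteq> 0" "(LEAST m. 0 < m \<and> A m) dvd n"
    using d assms by (simp_all flip: d_def)
qed

lemma perm_ord_dvd:
  assumes "bij g" "0 < n" "g ^^ n = id"
  shows "perm_ord g \<noteq> 0" "perm_ord g dvd n"
proof -
  have "g ^^ (k - l) = id" if "g ^^ k = id" "g ^^ l = id" "l \<le> k" for k l
    using that funpow_add[of "k - l" l g] by simp
  note L = Least_period_dvd[of n "\<lambda>n. g ^^ n = id", OF assms(2,3) this]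
  have eq: "perm_ord g = (LEAST n. 0 < n \<and> g ^^ n = id)"
    unfolding perm_ord_def by (intro if_P exI[of _ n] conjI assms)
  show "perm_ord g \<noteq> 0" unfolding eq by (rule L(1))
  show "perm_ord g dvd n" unfolding eq by (rule L(2))
qed

lemma funpow_eq_id_if_perm_ord_dvd:
  assumes "perm_ord g \<noteq> 0" "perm_ord g dvd n"
  shows "g ^^ n = id"
proof -
  have ex: "\<exists>n>0. g ^^ n = id" and eq: "perm_ord g = (LEAST n. 0 < n \<and> g ^^ n = id)"
    using assms(1) by (auto simp: perm_ord_def split: if_splits)
  have "g ^^ perm_ord g = id"
    unfolding eq using LeastI_ex[OF ex] by blast
  moreover obtain k where "n = perm_ord g * k" using assms(2) by blast
  ultimately show ?thesis by (simp add: funpow_mult[symmetric])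
qed

section \<open>The index r and periodicity in terms of \<open>S\<close>\<close>

context mperm
begin

lemma beta_sum: "\<beta> (\<Sum>k<n. ((f ^^ 3) ^^ k) x) y = S (int n) x y"
proof (induction n)
  case (Suc n)
  have "S (int (Suc n)) x y = S (int n) x y + \<beta> (((f ^^ 3) ^^ n) x) y"
    using S_Suc[of "int n" x y] by (simp add: zpow_of_nat add.commute)
  with Suc show ?case by (simp add: add_left)
qed simp

lemma sum_in_Rad_iff: "(\<Sum>k<n. ((f ^^ 3) ^^ k) x) \<in> R \<longleftrightarrow> (\<forall>y. S (int n) x y = 0)"
  by (simp add: Rad_def beta_sum)

lemma r_index_dvd:
  assumes "0 < n" "\<And>x y. S (int n) x y = 0"
  shows "r_index (f ^^ 3) \<beta> \<noteq> 0" "r_index (f ^^ 3) \<beta> dvd n"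
proof -
  let ?A = "\<lambda>n. \<forall>x. (\<Sum>k<n. ((f ^^ 3) ^^ k) x) \<in> R"
  have n: "?A n" using assms by (simp add: sum_in_Rad_iff)
  have "?A (k - l)" if "?A k" "?A l" "l \<le> k" for k l
    unfolding sum_in_Rad_iff
  proof (intro allI)
    fix x y
    \<comment> \<open>With x = g^l u the index shift expresses the value at k - l through the values
      at k and l.\<close>
    define u where "u = Z (- int l) x"
    have u: "Z (int l) u = x" by (simp add: u_def bij_g)
    have "S (int (k - l)) (Z (int l) u) y = 0"
      using that by (simp add: S_Z_left sum_in_Rad_iff of_nat_diff)
    then show "S (int (k - l)) x y = 0" by (simp add: u)
  qed
  note L = Least_period_dvd[of n ?A, OF assms(1) n this]
  have eq: "r_index (f ^^ 3) \<beta> = (LEAST n. 0 < n \<and> ?A n)"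
    unfolding r_index_def by (intro if_P exI[of _ n] conjI assms(1) n)
  show "r_index (f ^^ 3) \<beta> \<noteq> 0" unfolding eq by (rule L(1))
  show "r_index (f ^^ 3) \<beta> dvd n" unfolding eq by (rule L(2))
qed

lemma S_mult_period:
  assumes "\<And>x y. S n x y = 0"
  shows "S (n * t) x y = 0"
proof (induction t arbitrary: x y rule: int_induct[where k = 0])
  case (step1 i)
  then show ?case
    using S_Z_left[of "n * i" n x y] assms by (simp add: algebra_simps)
next
  case (step2 i)
  \<comment> \<open>The induction hypothesis is used at g^(-n) x; the same shift applied to the
    period n shows that \<open>S (- n) x y\<close> vanishes.\<close>
  have "S (n * i) (Z (- n) x) y = S (n * i - n) x y + S (- n) x y"
    using S_Z_left[of "n * i" "- n" x y] by simp
  moreover have "S n (Z (- n) x) y = S (- n) x y"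
    using S_Z_left[of n "- n" x y] by simp
  ultimately show ?case using step2 assms by (simp add: algebra_simps)
qed simp

lemma S_period_if_r_index_dvd:
  assumes "r_index (f ^^ 3) \<beta> \<noteq> 0" "r_index (f ^^ 3) \<beta> dvd n"
  shows "S (int n) x y = 0"
proof -
  define r where "r = r_index (f ^^ 3) \<beta>"
  have ex: "\<exists>r>0. \<forall>x. (\<Sum>k<r. ((f ^^ 3) ^^ k) x) \<in> R"
    and eq: "r = (LEAST r. r > 0 \<and> (\<forall>x. (\<Sum>k<r. ((f ^^ 3) ^^ k) x) \<in> R))"
    using assms(1) by (auto simp: r_def r_index_def split: if_splits)
  have "\<forall>x. (\<Sum>k<r. ((f ^^ 3) ^^ k) x) \<in> R"
    unfolding eq using LeastI_ex[OF ex] by blast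
  then have "S (int r) x y = 0" for x y by (simp add: sum_in_Rad_iff)
  moreover obtain t where "n = r * t" using assms(2) by (auto simp: r_def)
  ultimately show ?thesis using S_mult_period[of "int r" "int t"] by simp
qed

text \<open>By \<open>F_eq\<close> the exponents enter only through a power of g and two sums
  \<open>S\<close>, all periodic modulo n. The product therefore does not depend on the choice of
  logarithms.\<close>

lemma F_cong:
  assumes "\<And>x. Z n x = x" "\<And>x y. S n x y = 0" "n dvd i - i'" "n dvd j - j'"
  shows "F i j x y = F i' j' x y"
proof -
  have Z: "Z k x = Z l x" if "n dvd k - l" for k l x
  proof -
    from that obtain t where k: "k = n * t + l" by (auto simp: dvd_def algebra_simps)
    have "Z (n * t) y = y" for y
    proof (induction t rule: int_induct[where k = 0])
      case (step1 i)
      then show ?case using assms(1) Z_add[of n "n * i" y] by (simp add: algebra_simps)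
    next
      case (step2 i)
      then show ?case using assms(1) Z_add[of n "n * i - n" y] by (simp add: algebra_simps)
    qed simp
    then show ?thesis by (simp add: k Z_add)
  qed
  have S: "S k x y = S l x y" if "n dvd k - l" for k l x y
  proof -
    from that obtain t where k: "k - l = n * t" by (auto simp: dvd_def)
    have "S (k - l) (Z l x) y = 0" unfolding k by (rule S_mult_period) (rule assms(2))
    then have "S k x y + S l x y = 0" by (simp add: S_Z_left)
    then show ?thesis by (metis S_two add_right_cancel)
  qed
  have 1: "n dvd - j - - j'" using assms(4) by (simp add: dvd_diff_commute)
  have "n dvd (i - i') + (j - j')" using assms(3,4) by (rule dvd_add)
  then have 2: "n dvd (i + j) - (i' + j')" by (simp add: algebra_simps)
  show ?thesis unfolding F_eq Z[OF 1] S[OF 1] S[OF 2] ..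
qed

end

section \<open>Cyclic groups in which every element is a cube\<close>

locale cyclic_cubes = group C for C (structure) +
  fixes b
  assumes b_closed [simp]: "b \<in> carrier C"
    and carrier_eq: "carrier C = range (\<lambda>i::int. b [^] i)"
    and cubes: "\<forall>c\<in>carrier C. \<exists>d\<in>carrier C. c = d \<otimes> d \<otimes> d"
begin

text \<open>If b^k is a cube root of b, then b^(3k - 1) = 1, and 3k - 1 is never 0.\<close>

lemma finite_C: "finite (carrier C)"
proof -
  obtain d where d: "d \<in> carrier C" "b = d \<otimes> d \<otimes> d"
    using cubes b_closed by blast
  then obtain k :: int where k: "d = b [^] k"
    using carrier_eq by auto
  have "b [^] (1::int) = b [^] (3 * k)"
    using d(2) by (simp add: k int_pow_mult[symmetric] int_pow_1)
  then have "int (ord b) dvd 3 * k - 1"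
    by (subst (asm) int_pow_eq) simp_all
  then have "ord b \<noteq> 0"
  proof (rule contrapos_pn)
    assume "ord b = 0"
    moreover have "3 * k - 1 \<noteq> 0" by presburger
    ultimately show "\<not> int (ord b) dvd 3 * k - 1" by simp
  qed
  have "carrier C \<subseteq> (\<lambda>i. b [^] i) ` {0..<int (ord b)}"
  proof
    fix c assume "c \<in> carrier C"
    then obtain i :: int where i: "c = b [^] i" using carrier_eq by auto
    have "b [^] i = b [^] (i mod int (ord b))"
      by (subst int_pow_eq) (simp_all add: mod_eq_dvd_iff[symmetric])
    then show "c \<in> (\<lambda>i. b [^] i) ` {0..<int (ord b)}"
      using \<open>ord b \<noteq> 0\<close> by (auto simp: i)
  qed
  then show ?thesis by (rule finite_subset) simp
qed

lemma card_pos: "0 < card (carrier C)"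
  using finite_C one_closed by (auto simp: card_gt_0_iff)

lemma pow_card: "c \<in> carrier C \<Longrightarrow> c [^] card (carrier C) = \<one>"
  using pow_order_eq_1 by (simp add: order_def)

lemma ord_b: "ord b = card (carrier C)"
proof -
  have "carrier C = generate C {b}"
    by (subst carrier_eq) (simp add: generate_pow full_SetCompr_eq)
  then show ?thesis using generate_pow_card[OF b_closed] by simp
qed

lemma dlog: "c \<in> carrier C \<Longrightarrow> b [^] dlog C b c = c"
  unfolding dlog_def carrier_eq by (metis (mono_tags, lifting) imageE someI_ex)

lemma b_pow_eq: "b [^] (i::int) = b [^] j \<Longrightarrow> int (card (carrier C)) dvd i - j"
  using int_pow_eq[OF b_closed, of i j] by (simp add: ord_b dvd_diff_commute)

lemma cube_root:
  obtains a where "a \<in> carrier C" "b = a [^] (3::int)" "\<And>c. c \<in> carrier C \<Longrightarrow> \<exists>n::nat. c = a [^] n"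
proof -
  obtain a where a: "a \<in> carrier C" "b = a \<otimes> a \<otimes> a"
    using cubes b_closed by blast
  have a3: "b = a [^] (3::int)"
  proof -
    have "a [^] (3::int) = a [^] (1 + 1 + 1 :: int)" by simp
    also have "\<dots> = b" using a by (simp only: int_pow_mult int_pow_1)
    finally show ?thesis ..
  qed
  show thesis
  proof (rule that)
    fix c assume "c \<in> carrier C"
    then obtain i :: int where "c = b [^] i" using carrier_eq by auto
    then have c: "c = a [^] (3 * i)" using a by (simp add: a3 int_pow_pow)
    let ?n = "int (card (carrier C))"
    have 1: "a [^] ?n = \<one>" using pow_card[OF a(1)] by (simp add: int_pow_int)
    \<comment> \<open>Reduction modulo the order of C makes the exponent nonnegative.\<close>
    have "a [^] (3 * i) = a [^] (?n * (3 * i div ?n) + (3 * i) mod ?n)" by simp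
    also have "\<dots> = a [^] ((3 * i) mod ?n)"
      using a 1 by (simp only: int_pow_mult int_pow_pow[symmetric]) simp
    also have "\<dots> = a [^] nat ((3 * i) mod ?n)"
      using card_pos by (simp flip: int_pow_int)
    finally show "\<exists>n::nat. c = a [^] n" using c by blast
  qed (use a a3 in auto)
qed

end

section \<open>From Moufang permutations to Moufang loops\<close>

locale sdp_iso = cyclic_cubes C b + mperm f
  for C :: "('c, 'd) monoid_scheme" (structure) and b and f :: "'x::ab_group_add \<Rightarrow> 'x" +
  fixes Q :: "('q, 'e) monoid_scheme" and h :: "'q \<Rightarrow> 'c \<times> 'x"
  assumes loop_Q: "loop Q"
    and h_iso: "h \<in> iso Q (sdp_loop C b (f ^^ 3) (assoc_beta f))"
    and perm_ord: "perm_ord (f ^^ 3) \<noteq> 0" "perm_ord (f ^^ 3) dvd card (carrier C)"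
    and r_index: "r_index (f ^^ 3) (assoc_beta f) \<noteq> 0"
      "r_index (f ^^ 3) (assoc_beta f) dvd card (carrier C)"
begin

abbreviation mulQ (infixl \<open>\<otimes>Q\<close> 70) where "x \<otimes>Q y \<equiv> x \<otimes>\<^bsub>Q\<^esub> y"

definition \<pi> :: "'q \<Rightarrow> 'c" where "\<pi> q = fst (h q)"
definition \<sigma> :: "'q \<Rightarrow> 'x" where "\<sigma> q = snd (h q)"
abbreviation lg :: "'q \<Rightarrow> int" where "lg q \<equiv> dlog C b (\<pi> q)"

lemma Z_card: "Z (int (card (carrier C))) x = x"
  by (simp add: zpow_of_nat funpow_eq_id_if_perm_ord_dvd[OF perm_ord])

lemma F_period:
  assumes "int (card (carrier C)) dvd i - i'" "int (card (carrier C)) dvd j - j'"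
  shows "F i j x y = F i' j' x y"
  using F_cong[OF Z_card S_period_if_r_index_dvd[OF r_index] assms] .

lemma loopQ [simp]: "\<one>\<^bsub>Q\<^esub> \<in> carrier Q"
  "q \<in> carrier Q \<Longrightarrow> r \<in> carrier Q \<Longrightarrow> q \<otimes>Q r \<in> carrier Q"
  "q \<in> carrier Q \<Longrightarrow> \<one>\<^bsub>Q\<^esub> \<otimes>Q q = q"
  "q \<in> carrier Q \<Longrightarrow> q \<otimes>Q \<one>\<^bsub>Q\<^esub> = q"
  using loop_Q by (simp_all add: loop_def)

lemma ex1_div: "q \<in> carrier Q \<Longrightarrow> r \<in> carrier Q \<Longrightarrow> \<exists>!x. x \<in> carrier Q \<and> q \<otimes>Q x = r"
  "q \<in> carrier Q \<Longrightarrow> r \<in> carrier Q \<Longrightarrow> \<exists>!x. x \<in> carrier Q \<and> x \<otimes>Q q = r"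
  using loop_Q by (simp_all add: loop_def)

lemma \<pi>_closed [simp]: "q \<in> carrier Q \<Longrightarrow> \<pi> q \<in> carrier C"
proof -
  assume "q \<in> carrier Q"
  then have "h q \<in> carrier C \<times> UNIV"
    using h_iso unfolding iso_def sdp_loop_def by (auto dest: bij_betwE)
  then show ?thesis by (auto simp: \<pi>_def)
qed

lemma coords_surj: "c \<in> carrier C \<Longrightarrow> \<exists>q\<in>carrier Q. \<pi> q = c \<and> \<sigma> q = x"
proof -
  assume "c \<in> carrier C"
  moreover have "h ` carrier Q = carrier C \<times> UNIV"
    using h_iso by (simp add: iso_def bij_betw_def sdp_loop_def)
  ultimately have "(c, x) \<in> h ` carrier Q" by simp
  then obtain q where "q \<in> carrier Q" "h q = (c, x)" by (metis imageE)
  then show ?thesis by (intro bexI[of _ q]) (simp_all add: \<pi>_def \<sigma>_def)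
qed

lemma coords_eqI:
  assumes "q \<in> carrier Q" "r \<in> carrier Q" "\<pi> q = \<pi> r" "\<sigma> q = \<sigma> r"
  shows "q = r"
proof -
  have "inj_on h (carrier Q)" using h_iso by (simp add: iso_def bij_betw_def)
  moreover have "h q = h r" using assms(3,4) by (simp add: \<pi>_def \<sigma>_def prod_eq_iff)
  ultimately show ?thesis using assms(1,2) by (simp add: inj_on_eq_iff)
qed

lemma h_mult:
  assumes "q \<in> carrier Q" "r \<in> carrier Q"
  shows "h (q \<otimes>Q r) = (\<pi> q \<otimes> \<pi> r, F (lg q) (lg r) (\<sigma> q) (\<sigma> r))"
proof -
  have "h (q \<otimes>Q r) = h q \<otimes>\<^bsub>sdp_loop C b (f ^^ 3) (assoc_beta f)\<^esub> h r"
    using h_iso assms by (simp add: iso_def hom_def)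
  also have "\<dots> = (\<pi> q \<otimes> \<pi> r, F (lg q) (lg r) (\<sigma> q) (\<sigma> r))"
    by (simp add: sdp_loop_def \<pi>_def \<sigma>_def F_def Let_def case_prod_beta)
  finally show ?thesis .
qed

lemma \<pi>_mult [simp]: "q \<in> carrier Q \<Longrightarrow> r \<in> carrier Q \<Longrightarrow> \<pi> (q \<otimes>Q r) = \<pi> q \<otimes> \<pi> r"
  by (simp add: h_mult \<pi>_def[of "q \<otimes>Q r"])

lemma \<sigma>_mult: "q \<in> carrier Q \<Longrightarrow> r \<in> carrier Q \<Longrightarrow> \<sigma> (q \<otimes>Q r) = F (lg q) (lg r) (\<sigma> q) (\<sigma> r)"
  by (simp add: h_mult \<sigma>_def[of "q \<otimes>Q r"])

text \<open>The chosen logarithm of a product need not be the sum of the chosen logarithms;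
  periodicity of \<open>F\<close> allows any exponents that represent the two C-coordinates.\<close>

lemma \<sigma>_mult':
  assumes "q \<in> carrier Q" "r \<in> carrier Q" "b [^] i = \<pi> q" "b [^] j = \<pi> r"
  shows "\<sigma> (q \<otimes>Q r) = F i j (\<sigma> q) (\<sigma> r)"
  unfolding \<sigma>_mult[OF assms(1,2)]
  by (rule F_period) (rule b_pow_eq, use assms dlog in simp)+

lemma moufang_Q: "moufang_loop Q"
  unfolding moufang_loop_def
proof (intro conjI ballI loop_Q)
  fix x y z assume [simp]: "x \<in> carrier Q" "y \<in> carrier Q" "z \<in> carrier Q"
  show "x \<otimes>Q y \<otimes>Q (z \<otimes>Q x) = x \<otimes>Q (y \<otimes>Q z) \<otimes>Q x"
  proof (rule coords_eqI)
    let ?i = "lg x" and ?j = "lg y" and ?l = "lg z"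
    have [simp]: "b [^] ?i = \<pi> x" "b [^] ?j = \<pi> y" "b [^] ?l = \<pi> z"
      by (simp_all add: dlog)
    have "\<sigma> (x \<otimes>Q y \<otimes>Q (z \<otimes>Q x))
        = F (?i + ?j) (?l + ?i) (F ?i ?j (\<sigma> x) (\<sigma> y)) (F ?l ?i (\<sigma> z) (\<sigma> x))"
      by (subst \<sigma>_mult'[of _ _ "?i + ?j" "?l + ?i"]) (simp_all add: int_pow_mult \<sigma>_mult)
    also have "\<dots> = F (?i + (?j + ?l)) ?i (F ?i (?j + ?l) (\<sigma> x) (F ?j ?l (\<sigma> y) (\<sigma> z))) (\<sigma> x)"
      by (rule F_moufang)
    also have "\<dots> = \<sigma> (x \<otimes>Q (y \<otimes>Q z) \<otimes>Q x)"
      by (subst \<sigma>_mult'[of _ _ "?i + (?j + ?l)" ?i], simp_all add: int_pow_mult)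
        (subst \<sigma>_mult'[of _ _ ?i "?j + ?l"], simp_all add: int_pow_mult \<sigma>_mult)
    finally show "\<sigma> (x \<otimes>Q y \<otimes>Q (z \<otimes>Q x)) = \<sigma> (x \<otimes>Q (y \<otimes>Q z) \<otimes>Q x)" .
  qed (simp_all add: m_assoc)
qed

section \<open>The factors X and C inside the semidirect product\<close>

lemma F_zero [simp]: "F i j 0 y = y" "F i 0 x 0 = x" "F i j x 0 = Z (- j) x"
  by (simp_all add: F_eq)

lemma \<pi>_one [simp]: "\<pi> \<one>\<^bsub>Q\<^esub> = \<one>"
  using \<pi>_mult[of "\<one>\<^bsub>Q\<^esub>" "\<one>\<^bsub>Q\<^esub>"] by (simp del: \<pi>_mult)

lemma \<sigma>_mult_ker:
  assumes "q \<in> carrier Q" "r \<in> carrier Q" "\<pi> r = \<one>"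
  shows "\<pi> q = \<one> \<Longrightarrow> \<sigma> (q \<otimes>Q r) = \<sigma> q + \<sigma> r" "\<sigma> q = 0 \<Longrightarrow> \<sigma> (q \<otimes>Q r) = \<sigma> r"
proof -
  have "\<sigma> (q \<otimes>Q r) = \<sigma> q + \<sigma> r" if "\<pi> q = \<one>"
    using \<sigma>_mult'[of q r 0 0] assms that by (simp add: F_eq)
  then show "\<pi> q = \<one> \<Longrightarrow> \<sigma> (q \<otimes>Q r) = \<sigma> q + \<sigma> r" .
  show "\<sigma> q = 0 \<Longrightarrow> \<sigma> (q \<otimes>Q r) = \<sigma> r"
    using assms by (simp add: \<sigma>_mult)
qed

lemma \<sigma>_one [simp]: "\<sigma> \<one>\<^bsub>Q\<^esub> = 0"
  using \<sigma>_mult_ker(1)[of "\<one>\<^bsub>Q\<^esub>" "\<one>\<^bsub>Q\<^esub>"] by simp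

lemma subloopI:
  assumes "H \<subseteq> carrier Q" "\<one>\<^bsub>Q\<^esub> \<in> H" "\<And>x y. x \<in> H \<Longrightarrow> y \<in> H \<Longrightarrow> x \<otimes>Q y \<in> H"
    and "\<And>x y. x \<in> H \<Longrightarrow> y \<in> carrier Q \<Longrightarrow> x \<otimes>Q y \<in> H \<Longrightarrow> y \<in> H"
    and "\<And>x y. x \<in> H \<Longrightarrow> y \<in> carrier Q \<Longrightarrow> y \<otimes>Q x \<in> H \<Longrightarrow> y \<in> H"
  shows "subloop Q H"
proof -
  have "\<exists>!x. x \<in> H \<and> a \<otimes>Q x = c" "\<exists>!x. x \<in> H \<and> x \<otimes>Q a = c" if "a \<in> H" "c \<in> H" for a c
  proof -
    have ac: "a \<in> carrier Q" "c \<in> carrier Q" using that assms(1) by auto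
    have "x \<in> H \<and> a \<otimes>Q x = c \<longleftrightarrow> x \<in> carrier Q \<and> a \<otimes>Q x = c"
      "x \<in> H \<and> x \<otimes>Q a = c \<longleftrightarrow> x \<in> carrier Q \<and> x \<otimes>Q a = c" for x
      using that assms(1) assms(4,5)[of a x] by auto
    then show "\<exists>!x. x \<in> H \<and> a \<otimes>Q x = c" "\<exists>!x. x \<in> H \<and> x \<otimes>Q a = c"
      using ex1_div[OF ac] by simp_all
  qed
  moreover have "\<one>\<^bsub>Q\<^esub> \<otimes>Q x = x \<and> x \<otimes>Q \<one>\<^bsub>Q\<^esub> = x" if "x \<in> H" for x
    using that assms(1) by (simp add: subset_iff)
  ultimately show ?thesis
    using assms(1-3) by (simp add: subloop_def loop_def)
qed

text \<open>\<open>X'\<close> is the kernel of \<open>\<pi>\<close>; \<open>X'\<close> and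
  \<open>C'\<close> are the preimages under h of the two factors.\<close>

definition X' :: "'q set" where "X' = {q \<in> carrier Q. \<pi> q = \<one>}"
definition C' :: "'q set" where "C' = {q \<in> carrier Q. \<sigma> q = 0}"

lemma subloop_X': "subloop Q X'"
  by (rule subloopI) (auto simp: X'_def)

lemma subloop_C': "subloop Q C'"
proof (rule subloopI)
  fix x y assume "x \<in> C'" "y \<in> carrier Q" "y \<otimes>Q x \<in> C'"
  \<comment> \<open>Right multiplication by an element of \<open>C'\<close> acts on the X-coordinate
    as a power of g. Writing 0 as the image of 0 makes injectivity of that power applicable.\<close>
  then have "y \<in> carrier Q" "Z (- lg x) (\<sigma> y) = Z (- lg x) 0"
    by (auto simp: C'_def \<sigma>_mult)
  then show "y \<in> C'" by (simp add: C'_def zpow_inj[OF bij_g] del: Z_0)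
qed (auto simp: C'_def \<sigma>_mult)

text \<open>Normality compares images of the kernel under various translations t; each such image is
  a full fibre of \<open>\<pi>\<close>, so only C-coordinates have to be compared.\<close>

lemma fibre_eq:
  assumes q: "q \<in> carrier Q"
    and t: "\<And>n. n \<in> carrier Q \<Longrightarrow> t n \<in> carrier Q"
    and onto: "\<And>r. r \<in> carrier Q \<Longrightarrow> \<exists>n\<in>carrier Q. t n = r"
    and ker: "\<And>n. n \<in> carrier Q \<Longrightarrow> \<pi> (t n) = \<pi> q \<longleftrightarrow> \<pi> n = \<one>"
  shows "{t n | n. n \<in> X'} = {r \<in> carrier Q. \<pi> r = \<pi> q}"
proof (intro equalityI subsetI)
  fix r assume r: "r \<in> {r \<in> carrier Q. \<pi> r = \<pi> q}"
  then obtain n where "n \<in> carrier Q" "t n = r" using onto by blast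
  with r ker show "r \<in> {t n | n. n \<in> X'}" by (auto simp: X'_def)
qed (use t ker in \<open>auto simp: X'_def\<close>)

lemma normal_X': "normal_subloop Q X'"
proof -
  have onto: "\<exists>n\<in>carrier Q. x \<otimes>Q n = r" "\<exists>n\<in>carrier Q. n \<otimes>Q x = r"
    if "x \<in> carrier Q" "r \<in> carrier Q" for x r
    using ex1_div[OF that] by blast+
  have onto2: "\<exists>n\<in>carrier Q. x \<otimes>Q n \<otimes>Q y = r" "\<exists>n\<in>carrier Q. x \<otimes>Q (n \<otimes>Q y) = r"
    "\<exists>n\<in>carrier Q. y \<otimes>Q (x \<otimes>Q n) = r"
    if xyr: "x \<in> carrier Q" "y \<in> carrier Q" "r \<in> carrier Q" for x y r
  proof -
    obtain r' where r': "r' \<in> carrier Q" "r' \<otimes>Q y = r" using onto(2)[OF xyr(2,3)] by blast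
    show "\<exists>n\<in>carrier Q. x \<otimes>Q n \<otimes>Q y = r"
      using onto(1)[OF xyr(1) r'(1)] r'(2) by auto
    obtain r' where r': "r' \<in> carrier Q" "x \<otimes>Q r' = r" using onto(1)[OF xyr(1,3)] by blast
    show "\<exists>n\<in>carrier Q. x \<otimes>Q (n \<otimes>Q y) = r"
      using onto(2)[OF xyr(2) r'(1)] r'(2) by auto
    obtain r' where r': "r' \<in> carrier Q" "y \<otimes>Q r' = r" using onto(1)[OF xyr(2,3)] by blast
    show "\<exists>n\<in>carrier Q. y \<otimes>Q (x \<otimes>Q n) = r"
      using onto(1)[OF xyr(1) r'(1)] r'(2) by auto
  qed
  have k: "g \<otimes> n = g \<longleftrightarrow> n = \<one>" "n \<otimes> g = g \<longleftrightarrow> n = \<one>"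
    "g \<otimes> n \<otimes> k = g \<otimes> k \<longleftrightarrow> n = \<one>" "g \<otimes> (n \<otimes> k) = g \<otimes> k \<longleftrightarrow> n = \<one>"
    "k \<otimes> (g \<otimes> n) = k \<otimes> g \<longleftrightarrow> n = \<one>"
    if "g \<in> carrier C" "n \<in> carrier C" "k \<in> carrier C" for g n k
    using that by simp_all
  have "{x \<otimes>Q n | n. n \<in> X'} = {r \<in> carrier Q. \<pi> r = \<pi> x}"
    "{n \<otimes>Q x | n. n \<in> X'} = {r \<in> carrier Q. \<pi> r = \<pi> x}"
    if "x \<in> carrier Q" for x
    using that by (intro fibre_eq; simp add: onto k)+
  moreover have "{x \<otimes>Q n \<otimes>Q y | n. n \<in> X'} = {r \<in> carrier Q. \<pi> r = \<pi> (x \<otimes>Q y)}"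
    "{x \<otimes>Q (n \<otimes>Q y) | n. n \<in> X'} = {r \<in> carrier Q. \<pi> r = \<pi> (x \<otimes>Q y)}"
    "{y \<otimes>Q (x \<otimes>Q n) | n. n \<in> X'} = {r \<in> carrier Q. \<pi> r = \<pi> (y \<otimes>Q x)}"
    if "x \<in> carrier Q" "y \<in> carrier Q" for x y
    using that by (intro fibre_eq; simp add: onto2 k)+
  moreover have "{y \<otimes>Q x \<otimes>Q n | n. n \<in> X'} = {r \<in> carrier Q. \<pi> r = \<pi> (y \<otimes>Q x)}"
    if "x \<in> carrier Q" "y \<in> carrier Q" for x y
    using that by (intro fibre_eq; simp add: onto k)
  ultimately show ?thesis
    by (simp add: normal_subloop_def subloop_X')
qed

lemma X'_iso: "Q\<lparr>carrier := X'\<rparr> \<cong> (add_loop :: 'x monoid)"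
proof (rule is_isoI)
  have "bij_betw \<sigma> X' UNIV"
    unfolding bij_betw_def
  proof
    show "inj_on \<sigma> X'" by (auto simp: X'_def inj_on_def intro: coords_eqI)
    show "\<sigma> ` X' = UNIV"
    proof (intro equalityI subsetI)
      fix x
      obtain q where "q \<in> carrier Q" "\<pi> q = \<one>" "\<sigma> q = x"
        using coords_surj[OF one_closed] by blast
      then show "x \<in> \<sigma> ` X'" by (intro image_eqI[of _ _ q]) (simp_all add: X'_def)
    qed simp
  qed
  then show "\<sigma> \<in> iso (Q\<lparr>carrier := X'\<rparr>) add_loop"
    by (auto simp: iso_def hom_def add_loop_def X'_def \<sigma>_mult_ker)
qed

lemma C'_iso: "Q\<lparr>carrier := C'\<rparr> \<cong> C"
proof (rule is_isoI)
  have "bij_betw \<pi> C' (carrier C)"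
    unfolding bij_betw_def
  proof
    show "inj_on \<pi> C'" by (auto simp: C'_def inj_on_def intro: coords_eqI)
    show "\<pi> ` C' = carrier C"
    proof (intro equalityI subsetI)
      fix c assume "c \<in> carrier C"
      then obtain q where "q \<in> carrier Q" "\<pi> q = c" "\<sigma> q = 0"
        using coords_surj by blast
      then show "c \<in> \<pi> ` C'" by (intro image_eqI[of _ _ q]) (simp_all add: C'_def)
    qed (auto simp: C'_def)
  qed
  then show "\<pi> \<in> iso (Q\<lparr>carrier := C'\<rparr>) C"
    by (auto simp: iso_def hom_def C'_def)
qed

lemma carrier_eq_mult: "carrier Q = {c \<otimes>Q x | c x. c \<in> C' \<and> x \<in> X'}"
proof (intro equalityI subsetI)
  fix q assume q: "q \<in> carrier Q"
  obtain c where c: "c \<in> carrier Q" "\<pi> c = \<pi> q" "\<sigma> c = 0" using coords_surj q \<pi>_closed by blast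
  obtain x where x: "x \<in> carrier Q" "\<pi> x = \<one>" "\<sigma> x = \<sigma> q" using coords_surj by blast
  have "q = c \<otimes>Q x" by (rule coords_eqI) (use q c x \<sigma>_mult_ker in auto)
  with c x show "q \<in> {c \<otimes>Q x | c x. c \<in> C' \<and> x \<in> X'}" by (auto simp: C'_def X'_def)
qed (auto simp: C'_def X'_def)

lemma C'_Int_X': "C' \<inter> X' = {\<one>\<^bsub>Q\<^esub>}"
  by (auto simp: C'_def X'_def intro: coords_eqI)

end

section \<open>From Moufang loops to Moufang permutations\<close>

locale moufang_split = moufang_cyclic Q C \<psi> a + CC: cyclic_cubes C b
  for Q :: "('q, 'e) monoid_scheme" (structure) and C :: "('c, 'd) monoid_scheme" (structure)
    and \<psi> a b +
  fixes X' :: "'q set" and \<phi> :: "'x::ab_group_add \<Rightarrow> 'q"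
  assumes b_eq: "b = a [^]\<^bsub>C\<^esub> (3::int)"
    and normal: "normal_subloop Q X'"
    and range_\<phi>: "range \<phi> = X'" and inj_\<phi>: "inj \<phi>"
    and \<phi>_add: "\<phi> (x + y) = \<phi> x \<otimes>\<^bsub>Q\<^esub> \<phi> y"
    and inj_\<psi>: "inj_on \<psi> (carrier C)"
    and carrier_Q: "carrier Q = {c \<otimes>\<^bsub>Q\<^esub> x | c x. c \<in> \<psi> ` carrier C \<and> x \<in> X'}"
    and Int: "\<psi> ` carrier C \<inter> X' = {\<one>\<^bsub>Q\<^esub>}"
begin

lemma X'_subset: "X' \<subseteq> carrier Q"
  and loop_X': "Defs.loop (Q\<lparr>carrier := X'\<rparr>)"
  using normal by (simp_all add: normal_subloop_def subloop_def)

lemma \<phi>_in [simp]: "\<phi> x \<in> X'" "\<phi> x \<in> carrier Q"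
  using range_\<phi> X'_subset by blast+

lemma \<phi>_eq [simp]: "\<phi> x = \<phi> y \<longleftrightarrow> x = y"
  using inj_\<phi> by (simp add: inj_eq)

lemma \<phi>_0 [simp]: "\<phi> 0 = \<one>\<^bsub>Q\<^esub>"
  using \<phi>_add[of 0 0] l_cancel[of "\<phi> 0" "\<phi> 0" "\<one>\<^bsub>Q\<^esub>"] by simp

text \<open>Normality rewrites c x as n c with n in \<open>X'\<close>, after which c cancels against
  its inverse.\<close>

lemma cj_X':
  assumes "c \<in> carrier C" "x \<in> X'"
  shows "cj c x \<in> X'"
proof -
  have x: "x \<in> carrier Q" using assms X'_subset by blast
  have "{\<psi> c \<otimes> n | n. n \<in> X'} = {n \<otimes> \<psi> c | n. n \<in> X'}"
    using normal \<psi>_closed[OF assms(1)] unfolding normal_subloop_def by blast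
  then obtain n where n: "n \<in> X'" "\<psi> c \<otimes> x = n \<otimes> \<psi> c" using assms(2) by blast
  then have "n \<in> carrier Q" using X'_subset by blast
  then have "cj c x = n"
    using assms n(2) by (simp add: cj_def right_act)
  with n show ?thesis by simp
qed

definition f :: "'x \<Rightarrow> 'x" where "f x = inv_into UNIV \<phi> (cj a (\<phi> x))"

lemma \<phi>_f: "\<phi> (f x) = cj a (\<phi> x)"
  unfolding f_def by (rule f_inv_into_f) (simp add: range_\<phi> cj_X')

lemma cj_A_neg: "x \<in> carrier Q \<Longrightarrow> cj (A (- i)) (cj (A i) x) = x"
  by (simp add: cj_cj A_mult)

lemma cj_A_pos: "x \<in> carrier Q \<Longrightarrow> cj (A i) (cj (A (- i)) x) = x"
  by (simp add: cj_cj A_mult)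

lemma A_1: "A 1 = a"
  by simp

lemma bij_f: "bij f"
proof (rule bijI)
  show "inj f"
  proof (rule injI)
    fix x y assume "f x = f y"
    then have "cj (A 1) (\<phi> x) = cj (A 1) (\<phi> y)" by (simp only: A_1 flip: \<phi>_f)
    then have "\<phi> x = \<phi> y" using cj_A_neg[of _ 1] \<phi>_in(2) by metis
    then show "x = y" by simp
  qed
  show "surj f"
  proof (rule surjI)
    fix x
    have "\<phi> (f (inv_into UNIV \<phi> (cj (A (- 1)) (\<phi> x)))) = cj (A 1) (cj (A (- 1)) (\<phi> x))"
      by (subst \<phi>_f, subst f_inv_into_f) (simp_all only: range_\<phi> cj_X' A_closed \<phi>_in A_1)
    also have "\<dots> = \<phi> x" by (rule cj_A_pos) simp
    finally show "f (inv_into UNIV \<phi> (cj (A (- 1)) (\<phi> x))) = x" by (simp only: \<phi>_eq)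
  qed
qed

lemma \<phi>_zpow: "\<phi> (zpow f k x) = cj (A k) (\<phi> x)"
proof (induction k rule: int_induct[where k = 0])
  case (step1 i)
  have "\<phi> (zpow f (i + 1) x) = cj (A 1) (cj (A i) (\<phi> x))"
    by (simp only: zpow_Suc[OF bij_f] \<phi>_f step1 A_1)
  then show ?case by (simp only: cj_cj A_closed \<phi>_in A_mult add.commute)
next
  case (step2 i)
  have "\<phi> (f (zpow f (i - 1) x)) = cj (A i) (\<phi> x)"
    using zpow_Suc[OF bij_f, of "i - 1" x] step2 by simp
  then have "cj (A (- 1)) (cj (A 1) (\<phi> (zpow f (i - 1) x))) = cj (A (- 1)) (cj (A i) (\<phi> x))"
    by (simp only: \<phi>_f A_1)
  then show ?case by (simp only: cj_A_neg \<phi>_in cj_cj A_closed A_mult) simp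
qed (simp add: cj_def)

definition M :: "int \<Rightarrow> int \<Rightarrow> 'x \<Rightarrow> 'x \<Rightarrow> 'x" where
  "M i j x y = zpow f (- i - 2 * j) (zpow f (i - j) x + zpow f (i + 2 * j) y)"

text \<open>Since b = a^3, this is the element b^i x of Q, for an arbitrary integer i rather than a
  chosen logarithm.\<close>

definition \<Theta> :: "int \<Rightarrow> 'x \<Rightarrow> 'q" where
  "\<Theta> i x = \<psi> (A (3 * i)) \<otimes> \<phi> x"

lemma \<Theta>_closed [simp]: "\<Theta> i x \<in> carrier Q"
  by (simp add: \<Theta>_def)

lemma \<Theta>_eq: "\<Theta> i x = \<Theta> i y \<longleftrightarrow> x = y"
  by (simp add: \<Theta>_def l_cancel)

lemma \<Theta>_mult: "\<Theta> i x \<otimes> \<Theta> j y = \<Theta> (i + j) (M i j x y)"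
  unfolding \<Theta>_def mult_formula[OF \<phi>_in(2) \<phi>_in(2)] M_def
  by (simp only: \<phi>_zpow \<phi>_add)

lemma M_moufang:
  "M (i + j) (l + i) (M i j x y) (M l i z x) = M (i + (j + l)) i (M i (j + l) x (M j l y z)) x"
proof -
  have "(\<Theta> i x \<otimes> \<Theta> j y) \<otimes> (\<Theta> l z \<otimes> \<Theta> i x) = (\<Theta> i x \<otimes> (\<Theta> j y \<otimes> \<Theta> l z)) \<otimes> \<Theta> i x"
    by (rule moufang) simp_all
  then have "\<Theta> (i + j + (l + i)) (M (i + j) (l + i) (M i j x y) (M l i z x))
    = \<Theta> (i + (j + l) + i) (M (i + (j + l)) i (M i (j + l) x (M j l y z)) x)"
    by (simp only: \<Theta>_mult)
  moreover have "i + (j + l) + i = i + j + (l + i)" by simp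
  ultimately show ?thesis by (simp only: \<Theta>_eq)
qed

sublocale powers: moufang_powers f M
proof
  have "\<phi> (f 0) = \<phi> 0" by (subst \<phi>_f) simp
  then show "f 0 = 0" by (simp only: \<phi>_eq)
qed (rule bij_f M_def M_moufang)+

sublocale perm: mperm f
  by unfold_locales (rule powers.moufang_perm_f)

lemma zpow_card: "zpow f (int (card (carrier C)) * k) x = x"
proof -
  have "A (int (card (carrier C)) * k) = \<one>\<^bsub>C\<^esub>"
    using CC.pow_card[OF a_closed] by (simp add: int_pow_int C.int_pow_pow[symmetric])
  then have "\<phi> (zpow f (int (card (carrier C)) * k) x) = \<phi> x"
    by (simp only: \<phi>_zpow cj_one \<phi>_in)
  then show ?thesis by simp
qed

text \<open>The power of f with exponent the order of C is the identity, so conjugating addition by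
  it changes nothing, and \<open>P_conj\<close> shows \<open>S\<close> as the difference.\<close>

lemma S_card: "perm.S (int (card (carrier C))) x y = 0"
  using perm.P_conj[of "int (card (carrier C))" x y]
    zpow_card[of 1] zpow_card[of "- 1"] by simp

lemma g_card: "(f ^^ 3) ^^ card (carrier C) = id"
proof
  fix x
  have "((f ^^ 3) ^^ card (carrier C)) x = zpow f (int (card (carrier C)) * 3) x"
    using zpow_funpow[OF bij_f, of 3 "int (card (carrier C))" x] by (simp add: zpow_of_nat mult.commute)
  then show "((f ^^ 3) ^^ card (carrier C)) x = id x" by (simp add: zpow_card)
qed

lemma \<Theta>_dlog: "c \<in> carrier C \<Longrightarrow> \<Theta> (dlog C b c) x = \<psi> c \<otimes> \<phi> x"
  using CC.dlog[of c] by (simp add: \<Theta>_def b_eq C.int_pow_pow)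

lemma mult_coords:
  assumes "c \<in> carrier C" "d \<in> carrier C"
  shows "(\<psi> c \<otimes> \<phi> x) \<otimes> (\<psi> d \<otimes> \<phi> y)
    = \<psi> (c \<otimes>\<^bsub>C\<^esub> d) \<otimes> \<phi> (perm.F (dlog C b c) (dlog C b d) x y)"
proof -
  let ?i = "dlog C b c" and ?j = "dlog C b d"
  have "A (3 * (?i + ?j)) = c \<otimes>\<^bsub>C\<^esub> d"
    using CC.dlog[OF assms(1)] CC.dlog[OF assms(2)]
    by (simp add: b_eq C.int_pow_pow distrib_left C.int_pow_mult)
  then show ?thesis
    using \<Theta>_mult[of ?i x ?j y] assms
    by (simp add: \<Theta>_dlog) (simp add: \<Theta>_def M_def perm.F_conj)
qed

lemma coords_inj:
  assumes "c \<in> carrier C" "d \<in> carrier C" "\<psi> c \<otimes> \<phi> x = \<psi> d \<otimes> \<phi> y"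
  shows "c = d" "x = y"
proof -
  define e where "e = inv\<^bsub>C\<^esub> d \<otimes>\<^bsub>C\<^esub> c"
  have e: "e \<in> carrier C" using assms by (simp add: e_def)
  have "\<psi> e \<otimes> \<phi> x = \<psi> (inv\<^bsub>C\<^esub> d) \<otimes> (\<psi> d \<otimes> \<phi> y)"
    using assms by (simp add: e_def left_act flip: assms(3))
  also have "\<dots> = \<phi> y" using assms by (simp add: left_act)
  finally have exy: "\<psi> e \<otimes> \<phi> x = \<phi> y" .
  \<comment> \<open>The equation is solved inside the loop \<open>X'\<close>; cancellation in Q
    identifies the solution with \<open>\<psi> e\<close>, which thus lies in the trivial
    intersection.\<close>
  have "\<exists>!u. u \<in> X' \<and> u \<otimes> \<phi> x = \<phi> y"
    using loop_X' by (simp add: loop_def)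
  then obtain u where u: "u \<in> X'" "u \<otimes> \<phi> x = \<phi> y" by blast
  then have "u = \<psi> e"
    using exy r_cancel[of "\<phi> x" u "\<psi> e"] X'_subset e by auto
  then have "\<psi> e = \<psi> \<one>\<^bsub>C\<^esub>" using u e Int by auto
  then have "e = \<one>\<^bsub>C\<^esub>" using inj_\<psi> e by (simp only: inj_on_eq_iff C.one_closed)
  then show "c = d" using assms unfolding e_def
    by (metis C.inv_closed C.inv_equality C.inv_inv)
  then show "x = y" using assms by (simp add: l_cancel)
qed

lemma iso_sdp: "Q \<cong> sdp_loop C b (f ^^ 3) (assoc_beta f)"
proof (rule is_isoI)
  let ?S = "sdp_loop C b (f ^^ 3) (assoc_beta f)"
  define h where "h = (\<lambda>(c, x). \<psi> c \<otimes> \<phi> x)"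
  have carr: "carrier ?S = carrier C \<times> UNIV" by (simp add: sdp_loop_def)
  have mult: "p \<otimes>\<^bsub>?S\<^esub> q = (fst p \<otimes>\<^bsub>C\<^esub> fst q, perm.F (dlog C b (fst p)) (dlog C b (fst q)) (snd p) (snd q))"
    for p q
    by (simp add: sdp_loop_def perm.F_def Let_def case_prod_beta)
  have "inj_on h (carrier ?S)"
    by (rule inj_onI) (auto simp: h_def carr dest: coords_inj)
  moreover have "h ` carrier ?S = carrier Q"
  proof (intro equalityI subsetI)
    fix q assume "q \<in> carrier Q"
    then obtain c x where "c \<in> carrier C" "q = \<psi> c \<otimes> \<phi> x"
      unfolding carrier_Q using range_\<phi> by blast
    then show "q \<in> h ` carrier ?S"
      by (intro image_eqI[of _ _ "(c, x)"]) (simp_all add: h_def carr)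
  qed (auto simp: h_def carr)
  ultimately have bij: "bij_betw h (carrier ?S) (carrier Q)" by (simp add: bij_betw_def)
  have hom: "h (p \<otimes>\<^bsub>?S\<^esub> q) = h p \<otimes> h q" if "p \<in> carrier ?S" "q \<in> carrier ?S" for p q
    using that by (auto simp: h_def carr mult mult_coords)
  have closed: "p \<otimes>\<^bsub>?S\<^esub> q \<in> carrier ?S" if "p \<in> carrier ?S" "q \<in> carrier ?S" for p q
    using that by (auto simp: carr mult)
  \<comment> \<open>The explicit map h runs from the semidirect product to Q, so its inverse is the
    required isomorphism.\<close>
  show "inv_into (carrier ?S) h \<in> iso Q ?S"
    unfolding iso_def hom_def
  proof (safe intro!: bij_betw_inv_into bij)
    let ?k = "inv_into (carrier ?S) h"
    have k: "?k q \<in> carrier ?S" "h (?k q) = q" if "q \<in> carrier Q" for q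
      using bij that bij_betw_inv_into[OF bij] by (auto simp: bij_betw_inv_into_right dest: bij_betwE)
    show "?k q \<in> carrier ?S" if "q \<in> carrier Q" for q using k that by simp
    show "?k (q \<otimes> r) = ?k q \<otimes>\<^bsub>?S\<^esub> ?k r" if "q \<in> carrier Q" "r \<in> carrier Q" for q r
    proof (rule inv_into_f_eq)
      show "inj_on h (carrier ?S)" using bij by (simp add: bij_betw_def)
    qed (use that k hom closed in simp_all)
  qed
qed

end

theorem mainTheorem18:
  fixes C :: "('c, 'd) monoid_scheme" and b :: 'c and Q :: "('q, 'e) monoid_scheme"
  assumes "group C"
    and "b \<in> carrier C"
    and "carrier C = range (\<lambda>i::int. b [^]\<^bsub>C\<^esub> i)"
    and "\<forall>c\<in>carrier C. \<exists>d\<in>carrier C. c = d \<otimes>\<^bsub>C\<^esub> d \<otimes>\<^bsub>C\<^esub> d"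
    and "\<forall>x::'x::ab_group_add. \<exists>y. x = y + y + y"
    and "loop Q"
  shows "(moufang_loop Q \<and>
           (\<exists>X' C'. normal_subloop Q X' \<and> subloop Q C' \<and>
              Q\<lparr>carrier := X'\<rparr> \<cong> (add_loop :: 'x monoid) \<and>
              Q\<lparr>carrier := C'\<rparr> \<cong> C \<and>
              carrier Q = {c \<otimes>\<^bsub>Q\<^esub> x | c x. c \<in> C' \<and> x \<in> X'} \<and>
              C' \<inter> X' = {\<one>\<^bsub>Q\<^esub>}))
    \<longleftrightarrow>
         (\<exists>f :: 'x \<Rightarrow> 'x. moufang_perm f \<and>
            (finite (carrier C) \<longrightarrow>
               perm_ord (f ^^ 3) \<noteq> 0 \<and> perm_ord (f ^^ 3) dvd card (carrier C) \<and>
               r_index (f ^^ 3) (assoc_beta f) \<noteq> 0 \<and>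
               r_index (f ^^ 3) (assoc_beta f) dvd card (carrier C)) \<and>
            Q \<cong> sdp_loop C b (f ^^ 3) (assoc_beta f))" (is "?lhs \<longleftrightarrow> ?rhs")
proof
  interpret CC: cyclic_cubes C b
    using assms(1-4) by (simp add: cyclic_cubes_def cyclic_cubes_axioms_def)
  {
    assume ?lhs
    then obtain X' C' where moufang: "moufang_loop Q" and normal: "normal_subloop Q X'"
      and sub: "subloop Q C'"
      and X'_iso: "Q\<lparr>carrier := X'\<rparr> \<cong> (add_loop :: 'x monoid)"
      and C'_iso: "Q\<lparr>carrier := C'\<rparr> \<cong> C"
      and carrier_Q: "carrier Q = {c \<otimes>\<^bsub>Q\<^esub> x | c x. c \<in> C' \<and> x \<in> X'}"
      and Int: "C' \<inter> X' = {\<one>\<^bsub>Q\<^esub>}"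
      by blast
    obtain a where a: "a \<in> carrier C" "b = a [^]\<^bsub>C\<^esub> (3::int)"
      "\<And>c. c \<in> carrier C \<Longrightarrow> \<exists>n::nat. c = a [^]\<^bsub>C\<^esub> n"
      using CC.cube_root by metis
    obtain s where s: "bij_betw s X' (UNIV :: 'x set)"
      "\<And>x y. x \<in> X' \<Longrightarrow> y \<in> X' \<Longrightarrow> s (x \<otimes>\<^bsub>Q\<^esub> y) = s x + s y"
      using X'_iso by (auto simp: is_iso_def iso_def hom_def add_loop_def)
    obtain p where p: "bij_betw p C' (carrier C)"
      "\<And>x y. x \<in> C' \<Longrightarrow> y \<in> C' \<Longrightarrow> p (x \<otimes>\<^bsub>Q\<^esub> y) = p x \<otimes>\<^bsub>C\<^esub> p y"
      using C'_iso by (auto simp: is_iso_def iso_def hom_def)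
    \<comment> \<open>The given isomorphisms start at the subloops, whereas embeddings of X and C
      into Q are wanted, hence the inverses.\<close>
    define \<phi> \<psi> where "\<phi> = inv_into X' s" and "\<psi> = inv_into C' p"
    have C'_closed: "x \<otimes>\<^bsub>Q\<^esub> y \<in> C'" if "x \<in> C'" "y \<in> C'" for x y
      using sub that by (simp add: subloop_def loop_def)
    have X'_closed: "x \<otimes>\<^bsub>Q\<^esub> y \<in> X'" if "x \<in> X'" "y \<in> X'" for x y
      using normal that by (simp add: normal_subloop_def subloop_def loop_def)
    have C'_sub: "C' \<subseteq> carrier Q" using sub by (simp add: subloop_def)
    have \<phi>: "bij_betw \<phi> UNIV X'" and \<psi>: "bij_betw \<psi> (carrier C) C'"
      unfolding \<phi>_def \<psi>_def using s(1) p(1) by (simp_all add: bij_betw_inv_into)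
    have \<phi>_in: "\<phi> x \<in> X'" and \<psi>_in: "c \<in> carrier C \<Longrightarrow> \<psi> c \<in> C'" for x c
      using \<phi> \<psi> by (auto dest: bij_betwE)
    have s_\<phi>: "s (\<phi> x) = x" and p_\<psi>: "c \<in> carrier C \<Longrightarrow> p (\<psi> c) = c" for x c
      unfolding \<phi>_def \<psi>_def using s(1) p(1) by (simp_all add: bij_betw_inv_into_right)
    have \<phi>_add: "\<phi> (x + y) = \<phi> x \<otimes>\<^bsub>Q\<^esub> \<phi> y" for x y
    proof -
      have "s (\<phi> (x + y)) = s (\<phi> x \<otimes>\<^bsub>Q\<^esub> \<phi> y)" by (simp add: s_\<phi> s(2) \<phi>_in)
      then show ?thesis
        by (rule inj_onD[OF bij_betw_imp_inj_on[OF s(1)]]) (simp_all add: \<phi>_in X'_closed)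
    qed
    have \<psi>_mult: "\<psi> (c \<otimes>\<^bsub>C\<^esub> d) = \<psi> c \<otimes>\<^bsub>Q\<^esub> \<psi> d" if "c \<in> carrier C" "d \<in> carrier C" for c d
    proof -
      have "p (\<psi> (c \<otimes>\<^bsub>C\<^esub> d)) = p (\<psi> c \<otimes>\<^bsub>Q\<^esub> \<psi> d)" using that by (simp add: p_\<psi> p(2) \<psi>_in)
      then show ?thesis
        by (rule inj_onD[OF bij_betw_imp_inj_on[OF p(1)]]) (simp_all add: that \<psi>_in C'_closed)
    qed
    interpret moufang_split Q C \<psi> a b X' \<phi>
    proof
      show "moufang_loop Q" by (rule moufang)
      show "\<psi> c \<in> carrier Q" if "c \<in> carrier C" for c using that \<psi>_in C'_sub by blast
      have img: "\<psi> ` carrier C = C'" using \<psi> by (simp add: bij_betw_def)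
      show "carrier Q = {c \<otimes>\<^bsub>Q\<^esub> x | c x. c \<in> \<psi> ` carrier C \<and> x \<in> X'}"
        unfolding img by (rule carrier_Q)
      show "\<psi> ` carrier C \<inter> X' = {\<one>\<^bsub>Q\<^esub>}" unfolding img by (rule Int)
      show "range \<phi> = X'" "inj \<phi>" "inj_on \<psi> (carrier C)"
        using \<phi> \<psi> by (simp_all add: bij_betw_def)
    qed (use a normal \<phi>_add \<psi>_mult in simp_all)
    show ?rhs
    proof (intro exI[of _ f] conjI impI)
      show "moufang_perm f" by (rule powers.moufang_perm_f)
      show "perm_ord (f ^^ 3) \<noteq> 0" "perm_ord (f ^^ 3) dvd card (carrier C)"
        using perm_ord_dvd[OF perm.bij_g CC.card_pos g_card] by simp_all
      show "r_index (f ^^ 3) (assoc_beta f) \<noteq> 0"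
        "r_index (f ^^ 3) (assoc_beta f) dvd card (carrier C)"
        using perm.r_index_dvd[OF CC.card_pos S_card] by simp_all
      show "Q \<cong> sdp_loop C b (f ^^ 3) (assoc_beta f)" by (rule iso_sdp)
    qed
  next
    assume ?rhs
    \<comment> \<open>Finiteness of C, from \<open>CC.finite_C\<close>, turns the conditional
      divisibility statements into facts.\<close>
    then obtain f :: "'x \<Rightarrow> 'x" and h where f: "moufang_perm f"
      and ord: "perm_ord (f ^^ 3) \<noteq> 0" "perm_ord (f ^^ 3) dvd card (carrier C)"
        "r_index (f ^^ 3) (assoc_beta f) \<noteq> 0"
        "r_index (f ^^ 3) (assoc_beta f) dvd card (carrier C)"
      and h: "h \<in> iso Q (sdp_loop C b (f ^^ 3) (assoc_beta f))"
      using CC.finite_C unfolding is_iso_def by blast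
    interpret sdp_iso C b f Q h
      by unfold_locales (use f ord h assms(6) in simp_all)
    show ?lhs
      using moufang_Q normal_X' subloop_C' X'_iso C'_iso carrier_eq_mult C'_Int_X' by blast
  }
qed

end
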